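(* Consider the multinomial logistic regression model under complex survey design, with $\boldsymbol{M}$ a $d(k+1)\times r$ full rank matrix, $r\le d(k+1)$, and $\boldsymbol{m}$ an $r$-vector. Let $\widehat{\boldsymbol{\beta}}_{\phi,P}$ be the pseudo minimum $\phi$-divergence estimator of $\boldsymbol{\beta}$ and let $$W_{n}(\widehat{\boldsymbol{\beta}}_{\phi,P})=n\left(\boldsymbol{M}^T\widehat{\boldsymbol{\beta}}_{\phi,P}-\boldsymbol{m}\right)^T\left[\boldsymbol{M}^T\widehat{\mathbf{V}}_{n}(\widehat{\boldsymbol{\beta}}_{\phi,P})\boldsymbol{M}\right]^{-1}\left(\boldsymbol{M}^T\widehat{\boldsymbol{\beta}}_{\phi,P}-\boldsymbol{m}\right).$$ Under the null hypothesis $H_0:\boldsymbol{M}^T\boldsymbol{\beta}=\boldsymbol{m}$ (that is, when the true parameter value $\boldsymbol{\beta}^0$ satisfies $\boldsymbol{M}^T\boldsymbol{\beta}^0=\boldsymbol{m}$), the asymptotic distribution of $W_{n}(\widehat{\boldsymbol{\beta}}_{\phi,P})$ as $n\to\infty$ is a chi-square distribution with $r$ degrees of freedom.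
   Context: Model. There are $H$ strata; stratum $h$ has $n_h$ clusters; cluster $i$ of stratum $h$ has $m_{hi}$ units, sampling weight $w_{hi}$ and common covariate vector $\boldsymbol{x}_{hi}\in\mathbb{R}^{k+1}$ whose first entry is $1$. Each unit has a categorical response with $d+1$ categories, coded as an indicator vector $\boldsymbol{Y}_{hij}\in\{0,1\}^{d+1}$ with $\mathrm{E}[\boldsymbol{Y}_{hij}\mid\boldsymbol{x}_{hi}]=\boldsymbol{\pi}_{hi}(\boldsymbol{\beta})$, where $\pi_{hir}(\boldsymbol{\beta})=\exp\{\boldsymbol{x}_{hi}^T\boldsymbol{\beta}_r\}/(1+\sum_{l=1}^d\exp\{\boldsymbol{x}_{hi}^T\boldsymbol{\beta}_l\})$ for $r=1,\dots,d$, $\pi_{hi,d+1}(\boldsymbol{\beta})=1/(1+\sum_{l=1}^d\exp\{\boldsymbol{x}_{hi}^T\boldsymbol{\beta}_l\})$, and $\boldsymbol{\beta}=(\boldsymbol{\beta}_1^T,\dots,\boldsymbol{\beta}_d^T)^T\in\Theta=\mathbb{R}^{d(k+1)}$. Units in one cluster may be correlated; different clusters are independent. $\widehat{\boldsymbol{Y}}_{hi}=\sum_{j=1}^{m_{hi}}\boldsymbol{Y}_{hij}$ is the vector of counts, with realization $\widehat{\boldsymbol{y}}_{hi}$. A superscript $*$ on a vector means its last component is deleted. $\boldsymbol{\Delta}(\boldsymbol{p})=\mathrm{diag}(\boldsymbol{p})-\boldsymbol{p}\boldsymbol{p}^T$; $\otimes$ is the Kronecker product; $n=\sum_h n_h$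 is the total number of clusters; $\tau=\sum_{h}\sum_i w_{hi}m_{hi}$. Estimator. Let $\Phi^*$ be the class of convex $\phi:[0,\infty)\to\mathbb{R}\cup\{\infty\}$ with $\phi(1)=0$, $\phi''(1)>0$, with conventions $0\phi(0/0)=0$ and $0\phi(p/0)=p\lim_{u\to\infty}\phi(u)/u$. For $\phi\in\Phi^*$, $\widehat{\boldsymbol{\beta}}_{\phi,P}$ is the minimizer over $\boldsymbol{\beta}\in\Theta$ of $$\frac1\tau\sum_{h=1}^H\sum_{i=1}^{n_h}w_{hi}m_{hi}\sum_{s=1}^{d+1}\pi_{his}(\boldsymbol{\beta})\,\phi\!\left(\frac{\widehat y_{his}}{m_{hi}\pi_{his}(\boldsymbol{\beta})}\right).$$ Matrices. Let $\boldsymbol{u}_{hi}(\boldsymbol{\beta})=w_{hi}(\widehat{\boldsymbol{y}}^*_{hi}-m_{hi}\boldsymbol{\pi}^*_{hi}(\boldsymbol{\beta}))\otimes\boldsymbol{x}_{hi}$, $\boldsymbol{u}(\boldsymbol{\beta})=\sum_h\sum_i\boldsymbol{u}_{hi}(\boldsymbol{\beta})$, and $$\widehat{\mathbf{J}}_n(\boldsymbol{\beta})=\mathbf{J}_n(\boldsymbol{\beta})=\frac1n\sum_h\sum_i w_{hi}m_{hi}\boldsymbol{\Delta}(\boldsymbol{\pi}^*_{hi}(\boldsymbol{\beta}))\otimes\boldsymbol{x}_{hi}\boldsymbol{x}_{hi}^T,\qquad \mathbf{G}_n(\boldsymbol{\beta})=\frac1n\sum_h\sum_i w_{hi}^2\mathrm{Var}[\widehat{\boldsymbol{Y}}^*_{hi}]\otimes\boldsymbol{x}_{hi}\boldsymbol{x}_{hi}^T,$$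 $$\widehat{\mathbf{G}}_n(\boldsymbol{\beta})=\frac1n\sum_h\sum_i\left(\boldsymbol{u}_{hi}(\boldsymbol{\beta})-\tfrac1n\boldsymbol{u}(\boldsymbol{\beta})\right)\left(\boldsymbol{u}_{hi}(\boldsymbol{\beta})-\tfrac1n\boldsymbol{u}(\boldsymbol{\beta})\right)^T.$$ Put $\widehat{\mathbf{V}}_n=\widehat{\mathbf{J}}_n^{-1}\widehat{\mathbf{G}}_n\widehat{\mathbf{J}}_n^{-1}$, $\mathbf{J}=\lim_n\mathbf{J}_n$, $\mathbf{G}=\lim_n\mathbf{G}_n$, $\mathbf{V}=\mathbf{J}^{-1}\mathbf{G}\mathbf{J}^{-1}$. Standing facts (known from earlier work and taken as given). As $n\to\infty$ with $n_h/n\to\eta_h^*$ for each $h$, the limits $\mathbf{J},\mathbf{G}$ exist, $\sqrt n(\widehat{\boldsymbol{\beta}}_{\phi,P}-\boldsymbol{\beta}^0)$ converges in law to $\mathcal{N}(\boldsymbol{0}_{d(k+1)},\mathbf{V}(\boldsymbol{\beta}^0))$, where $\boldsymbol{\beta}^0$ is the true parameter value, and $\widehat{\mathbf{J}}_n(\widehat{\boldsymbol{\beta}}_{\phi,P})$, $\widehat{\mathbf{G}}_n(\widehat{\boldsymbol{\beta}}_{\phi,P})$ are consistent estimators of $\mathbf{J}(\boldsymbol{\beta}^0)$, $\mathbf{G}(\boldsymbol{\beta}^0)$. The matrices whose inverses appear, in particular $\mathbf{J}(\boldsymbol{\beta}^0)$ and $\boldsymbol{M}^T\mathbf{V}(\boldsymbol{\beta}^0)\boldsymbol{M}$,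 are invertible. *)

theory Defs
  imports "HOL-Probability.Probability"
begin

text \<open>
  Index conventions: the \<open>d\<close> non-reference categories are the elements of a finite type \<open>'d\<close>, and
  \<open>'d option\<close> indexes all \<open>d + 1\<close> categories, with \<open>None\<close> playing the role of the last one.  The
  \<open>k + 1\<close> covariates are indexed by a finite type \<open>'q\<close>.  The parameter
  \<open>\<beta> = (\<beta>\<^sub>1, \<dots>, \<beta>\<^sub>d)\<close> is a vector indexed by \<open>'d \<times> 'q\<close>, with
  \<open>\<beta> $ (r, c)\<close> the \<open>c\<close>-th entry of \<open>\<beta>\<^sub>r\<close>; Kronecker products are indexed in the same way.
\<close>


section \<open>Vectors and matrices\<close>

definition kron_vec :: "real ^ 'd \<Rightarrow> real ^ 'q \<Rightarrow> real ^ ('d \<times> 'q)" where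
  "kron_vec u x = (\<chi> k. u $ fst k * x $ snd k)"

definition kron_mat :: "real ^ 'd ^ 'd \<Rightarrow> real ^ 'q ^ 'q \<Rightarrow> real ^ ('d \<times> 'q) ^ ('d \<times> 'q)" where
  "kron_mat A B = (\<chi> k l. A $ fst k $ fst l * B $ snd k $ snd l)"

definition outer_prod :: "real ^ 'n \<Rightarrow> real ^ 'n \<Rightarrow> real ^ 'n ^ 'n" where
  "outer_prod u v = (\<chi> i j. u $ i * v $ j)"

definition Delta_mat :: "real ^ 'n \<Rightarrow> real ^ 'n ^ 'n" where
  "Delta_mat p = (\<chi> i j. if i = j then p $ i else 0) - outer_prod p p"

definition drop_last :: "real ^ ('d option) \<Rightarrow> real ^ 'd" where
  "drop_last v = (\<chi> r. v $ Some r)"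

definition covariance_mat :: "'a measure \<Rightarrow> ('a \<Rightarrow> real ^ 'n) \<Rightarrow> real ^ 'n ^ 'n" where
  "covariance_mat P Z =
     (\<chi> i j. \<integral>\<omega>. (Z \<omega> $ i - (\<integral>\<omega>'. Z \<omega>' $ i \<partial>P)) * (Z \<omega> $ j - (\<integral>\<omega>'. Z \<omega>' $ j \<partial>P)) \<partial>P)"


section \<open>Distributions and modes of convergence\<close>

definition std_mv_normal :: "(real ^ 'n) measure" where
  "std_mv_normal = density lborel (\<lambda>z. ennreal (\<Prod>i\<in>UNIV. std_normal_density (z $ i)))"

text \<open>
  \<open>\<nu>\<close> is the law \<open>N(\<mu>, \<Sigma>)\<close>: the law of \<open>\<mu> + A Z\<close> with \<open>Z\<close> standard normal and
  \<open>A A\<^sup>T = \<Sigma>\<close>.  A singular \<open>\<Sigma>\<close> is allowed.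
\<close>
definition mv_normal :: "(real ^ 'n) measure \<Rightarrow> real ^ 'n \<Rightarrow> real ^ 'n ^ 'n \<Rightarrow> bool" where
  "mv_normal \<nu> \<mu> \<Sigma> \<longleftrightarrow>
     (\<exists>A :: real ^ 'n ^ 'n. A ** transpose A = \<Sigma> \<and> \<nu> = distr std_mv_normal borel (\<lambda>z. \<mu> + A *v z))"

text \<open>The law of the sum of the squares of \<open>r\<close> independent standard normal variables.\<close>
definition chi_square :: "nat \<Rightarrow> real measure" where
  "chi_square r =
     distr (Pi\<^sub>M {..<r} (\<lambda>_. density lborel std_normal_density)) borel (\<lambda>z. \<Sum>i<r. (z i)\<^sup>2)"

text \<open>
  Weak convergence of measures on a general topological space; \<^const>\<open>weak_conv_m\<close> covers the
  real line only.
\<close>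
definition weak_conv_measures :: "(nat \<Rightarrow> 'b :: topological_space measure) \<Rightarrow> 'b measure \<Rightarrow> bool" where
  "weak_conv_measures \<mu>s \<mu> \<longleftrightarrow>
     (\<forall>f :: 'b \<Rightarrow> real. continuous_on UNIV f \<longrightarrow> bounded (range f) \<longrightarrow>
        (\<lambda>n. \<integral>x. f x \<partial>\<mu>s n) \<longlonglongrightarrow> (\<integral>x. f x \<partial>\<mu>))"

definition tendsto_in_prob :: "'a measure \<Rightarrow> (nat \<Rightarrow> 'a \<Rightarrow> 'b :: metric_space) \<Rightarrow> 'b \<Rightarrow> bool" where
  "tendsto_in_prob P X c \<longleftrightarrow>
     (\<forall>\<epsilon>>0. (\<lambda>n. measure P {\<omega> \<in> space P. dist (X n \<omega>) c > \<epsilon>}) \<longlonglongrightarrow> 0)"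


section \<open>The survey design and the multinomial logistic model\<close>

text \<open>
  Strata \<open>h\<close>, clusters \<open>i\<close> and units \<open>j\<close> are numbered from 1; the values of the fields outside
  these ranges are irrelevant.
\<close>
record 'q design =
  strata :: nat
  clusters :: "nat \<Rightarrow> nat"
  units :: "nat \<Rightarrow> nat \<Rightarrow> nat"
  weight :: "nat \<Rightarrow> nat \<Rightarrow> real"
  covar :: "nat \<Rightarrow> nat \<Rightarrow> real ^ 'q"

definition cluster_index :: "('q :: finite) design \<Rightarrow> (nat \<times> nat) set" where
  "cluster_index D = (SIGMA h:{1..strata D}. {1..clusters D h})"

definition num_clusters :: "('q :: finite) design \<Rightarrow> nat" where
  "num_clusters D = (\<Sum>h=1..strata D. clusters D h)"

definition total_weight :: "('q :: finite) design \<Rightarrow> real" where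
  "total_weight D = (\<Sum>h=1..strata D. \<Sum>i=1..clusters D h. weight D h i * real (units D h i))"

definition lin_pred :: "real ^ 'q \<Rightarrow> real ^ (('d :: finite) \<times> 'q) \<Rightarrow> 'd \<Rightarrow> real" where
  "lin_pred x \<beta> r = x \<bullet> (\<chi> c. \<beta> $ (r, c))"

definition logistic_prob :: "real ^ 'q \<Rightarrow> real ^ (('d :: finite) \<times> 'q) \<Rightarrow> real ^ ('d option)" where
  "logistic_prob x \<beta> =
     (\<chi> s. (case s of Some r \<Rightarrow> exp (lin_pred x \<beta> r) | None \<Rightarrow> 1)
            / (1 + (\<Sum>l\<in>UNIV. exp (lin_pred x \<beta> l))))"

text \<open>
  \<open>Y h i j\<close> is the response vector of unit \<open>j\<close> in cluster \<open>i\<close> of stratum \<open>h\<close>, and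
  \<open>\<beta>\<^sub>0\<close> is the true parameter.  The covariates are fixed, i.e. \<open>P\<close> is the law given the
  covariates.  \<open>first\<close> is the coordinate of the intercept.  Nothing is assumed about the dependence
  within a cluster.
\<close>
locale survey_model = prob_space P
  for P :: "'a measure" and D :: "('q :: finite) design" and first :: 'q
    and Y :: "nat \<Rightarrow> nat \<Rightarrow> nat \<Rightarrow> 'a \<Rightarrow> real ^ (('d :: finite) option)"
    and \<beta>\<^sub>0 :: "real ^ ('d \<times> 'q)" +
  assumes weight_pos: "(h, i) \<in> cluster_index D \<Longrightarrow> 0 < weight D h i"
    and units_pos: "(h, i) \<in> cluster_index D \<Longrightarrow> 1 \<le> units D h i"
    and covar_first: "(h, i) \<in> cluster_index D \<Longrightarrow> covar D h i $ first = 1"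
    and Y_measurable: "(h, i) \<in> cluster_index D \<Longrightarrow> j \<in> {1..units D h i} \<Longrightarrow>
          Y h i j \<in> borel_measurable P"
    and Y_indicator: "(h, i) \<in> cluster_index D \<Longrightarrow> j \<in> {1..units D h i} \<Longrightarrow> \<omega> \<in> space P \<Longrightarrow>
          \<exists>s. Y h i j \<omega> = axis s 1"
    and Y_mean: "(h, i) \<in> cluster_index D \<Longrightarrow> j \<in> {1..units D h i} \<Longrightarrow>
          expectation (Y h i j) = logistic_prob (covar D h i) \<beta>\<^sub>0"
    and clusters_indep: "indep_vars (\<lambda>(h, i). Pi\<^sub>M {1..units D h i} (\<lambda>_. borel))
          (\<lambda>(h, i) \<omega>. \<lambda>j\<in>{1..units D h i}. Y h i j \<omega>) (cluster_index D)"


section \<open>The pseudo minimum phi-divergence estimator\<close>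

text \<open>In the following, \<open>y h i j\<close> denotes the realized responses.\<close>

definition counts :: "('q :: finite) design \<Rightarrow> (nat \<Rightarrow> nat \<Rightarrow> nat \<Rightarrow> real ^ 's) \<Rightarrow> nat \<Rightarrow> nat \<Rightarrow> real ^ 's" where
  "counts D y h i = (\<Sum>j=1..units D h i. y h i j)"

text \<open>
  Only the values on \<open>[0, \<infinity>)\<close> matter.  The last conjunct says that \<open>\<phi>\<close> is finite and
  differentiable near 1 and that \<open>\<phi>''(1)\<close> exists and is positive.
\<close>
definition phi_class :: "(real \<Rightarrow> ereal) set" where
  "phi_class = {\<phi>.
     (\<forall>u\<ge>0. \<phi> u \<noteq> -\<infinity>) \<and>
     (\<forall>u\<ge>0. \<forall>v\<ge>0. \<forall>t\<in>{0..1}.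
        \<phi> ((1 - t) * u + t * v) \<le> ereal (1 - t) * \<phi> u + ereal t * \<phi> v) \<and>
     \<phi> 1 = 0 \<and>
     (\<exists>\<phi>' c.
        (\<forall>\<^sub>F u in nhds 1. \<bar>\<phi> u\<bar> \<noteq> \<infinity> \<and>
           ((\<lambda>v. real_of_ereal (\<phi> v)) has_real_derivative \<phi>' u) (at u)) \<and>
        (\<phi>' has_real_derivative c) (at 1) \<and> 0 < c)}"

text \<open>\<open>q \<phi>(p/q)\<close> with the usual conventions for \<open>q = 0\<close>\<close>
definition phi_term :: "(real \<Rightarrow> ereal) \<Rightarrow> real \<Rightarrow> real \<Rightarrow> ereal" where
  "phi_term \<phi> p q =
     (if q \<noteq> 0 then ereal q * \<phi> (p / q)
      else if p = 0 then 0
      else ereal p * Lim at_top (\<lambda>u. \<phi> u / ereal u))"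

definition phi_loss ::
  "('q :: finite) design \<Rightarrow> (real \<Rightarrow> ereal) \<Rightarrow> (nat \<Rightarrow> nat \<Rightarrow> nat \<Rightarrow> real ^ (('d :: finite) option)) \<Rightarrow> real ^ ('d \<times> 'q) \<Rightarrow> ereal"
where
  "phi_loss D \<phi> y \<beta> = ereal (1 / total_weight D) *
     (\<Sum>h=1..strata D. \<Sum>i=1..clusters D h. ereal (weight D h i * real (units D h i)) *
        (\<Sum>s\<in>UNIV. phi_term \<phi> (counts D y h i $ s / real (units D h i))
                              (logistic_prob (covar D h i) \<beta> $ s)))"

text \<open>
  For finite samples the loss need not attain its infimum (e.g. when all responses fall into one
  category), so the estimator is constrained only on the outcomes for which a minimizer exists.
\<close>
definition pseudo_min_phi_estimator ::
  "'a measure \<Rightarrow> ('q :: finite) design \<Rightarrow> (nat \<Rightarrow> nat \<Rightarrow> nat \<Rightarrow> 'a \<Rightarrow> real ^ (('d :: finite) option)) \<Rightarrow> (real \<Rightarrow> ereal) \<Rightarrow>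
   ('a \<Rightarrow> real ^ ('d \<times> 'q)) \<Rightarrow> bool" where
  "pseudo_min_phi_estimator P D Y \<phi> bhat \<longleftrightarrow>
     bhat \<in> borel_measurable P \<and>
     (\<forall>\<omega>\<in>space P.
        (\<exists>b. is_arg_min (phi_loss D \<phi> (\<lambda>h i j. Y h i j \<omega>)) (\<lambda>_. True) b) \<longrightarrow>
        is_arg_min (phi_loss D \<phi> (\<lambda>h i j. Y h i j \<omega>)) (\<lambda>_. True) (bhat \<omega>))"


section \<open>The matrices and the Wald statistic\<close>

definition score_hi ::
  "('q :: finite) design \<Rightarrow> (nat \<Rightarrow> nat \<Rightarrow> nat \<Rightarrow> real ^ (('d :: finite) option)) \<Rightarrow> real ^ ('d \<times> 'q) \<Rightarrow> nat \<Rightarrow> nat \<Rightarrow> real ^ ('d \<times> 'q)"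
where
  "score_hi D y \<beta> h i = weight D h i *\<^sub>R
     kron_vec (drop_last (counts D y h i)
                 - real (units D h i) *\<^sub>R drop_last (logistic_prob (covar D h i) \<beta>))
       (covar D h i)"

definition score ::
  "('q :: finite) design \<Rightarrow> (nat \<Rightarrow> nat \<Rightarrow> nat \<Rightarrow> real ^ (('d :: finite) option)) \<Rightarrow> real ^ ('d \<times> 'q) \<Rightarrow> real ^ ('d \<times> 'q)" where
  "score D y \<beta> = (\<Sum>h=1..strata D. \<Sum>i=1..clusters D h. score_hi D y \<beta> h i)"

definition J_mat :: "('q :: finite) design \<Rightarrow> real ^ (('d :: finite) \<times> 'q) \<Rightarrow> real ^ ('d \<times> 'q) ^ ('d \<times> 'q)" where
  "J_mat D \<beta> = (1 / real (num_clusters D)) *\<^sub>R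
     (\<Sum>h=1..strata D. \<Sum>i=1..clusters D h. (weight D h i * real (units D h i)) *\<^sub>R
        kron_mat (Delta_mat (drop_last (logistic_prob (covar D h i) \<beta>)))
                 (outer_prod (covar D h i) (covar D h i)))"

text \<open>
  The variance is taken under the law \<open>P\<close> of the data, so when \<open>P\<close> is the law under the true
  parameter \<open>\<beta>\<^sub>0\<close>, this is \<open>G\<^sub>n(\<beta>\<^sub>0)\<close>.
\<close>
definition G_mat ::
  "'a measure \<Rightarrow> ('q :: finite) design \<Rightarrow> (nat \<Rightarrow> nat \<Rightarrow> nat \<Rightarrow> 'a \<Rightarrow> real ^ (('d :: finite) option)) \<Rightarrow>
   real ^ ('d \<times> 'q) ^ ('d \<times> 'q)" where
  "G_mat P D Y = (1 / real (num_clusters D)) *\<^sub>R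
     (\<Sum>h=1..strata D. \<Sum>i=1..clusters D h. (weight D h i)\<^sup>2 *\<^sub>R
        kron_mat (covariance_mat P (\<lambda>\<omega>. drop_last (counts D (\<lambda>h i j. Y h i j \<omega>) h i)))
                 (outer_prod (covar D h i) (covar D h i)))"

definition G_hat ::
  "('q :: finite) design \<Rightarrow> (nat \<Rightarrow> nat \<Rightarrow> nat \<Rightarrow> real ^ (('d :: finite) option)) \<Rightarrow> real ^ ('d \<times> 'q) \<Rightarrow>
   real ^ ('d \<times> 'q) ^ ('d \<times> 'q)" where
  "G_hat D y \<beta> = (1 / real (num_clusters D)) *\<^sub>R
     (\<Sum>h=1..strata D. \<Sum>i=1..clusters D h.
        outer_prod (score_hi D y \<beta> h i - (1 / real (num_clusters D)) *\<^sub>R score D y \<beta>)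
                   (score_hi D y \<beta> h i - (1 / real (num_clusters D)) *\<^sub>R score D y \<beta>))"

definition sandwich :: "real ^ 'n ^ 'n \<Rightarrow> real ^ 'n ^ 'n \<Rightarrow> real ^ 'n ^ 'n" where
  "sandwich J G = matrix_inv J ** G ** matrix_inv J"

definition V_hat ::
  "('q :: finite) design \<Rightarrow> (nat \<Rightarrow> nat \<Rightarrow> nat \<Rightarrow> real ^ (('d :: finite) option)) \<Rightarrow> real ^ ('d \<times> 'q) \<Rightarrow>
   real ^ ('d \<times> 'q) ^ ('d \<times> 'q)" where
  "V_hat D y \<beta> = sandwich (J_mat D \<beta>) (G_hat D y \<beta>)"

text \<open>
  \<^const>\<open>matrix_inv\<close> is total: it has one fixed unspecified value on all singular matrices.
\<close>
definition wald_stat ::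
  "('q :: finite) design \<Rightarrow> (nat \<Rightarrow> nat \<Rightarrow> nat \<Rightarrow> real ^ (('d :: finite) option)) \<Rightarrow> real ^ 'r ^ ('d \<times> 'q) \<Rightarrow> real ^ 'r \<Rightarrow>
   real ^ ('d \<times> 'q) \<Rightarrow> real" where
  "wald_stat D y M m \<beta> = real (num_clusters D) *
     ((transpose M *v \<beta> - m) \<bullet>
      (matrix_inv (transpose M ** V_hat D y \<beta> ** M) *v (transpose M *v \<beta> - m)))"

end

theory Submission
  imports Defs
begin

text \<open>
  Under \<open>H\<^sub>0\<close> the statistic is \<open>g(Z\<^sub>n, X\<^sub>n)\<close> with \<open>g(z, x) = (M\<^sup>T z)\<^sup>T x (M\<^sup>T z)\<close>, where
  \<open>Z\<^sub>n = \<surd>n (\<beta>\<^sub>n - \<beta>\<^sub>0)\<close> is asymptotically normal with covariance \<open>V\<close>, and \<open>X\<^sub>n\<close>, the inverse of the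
  estimated covariance of \<open>M\<^sup>T Z\<^sub>n\<close>, tends in probability to \<open>(M\<^sup>T V M)\<^sup>-\<^sup>1\<close> because matrix inversion
  is continuous at invertible matrices.  By Slutsky's theorem the limit law is that of
  \<open>(B Z)\<^sup>T (B B\<^sup>T)\<^sup>-\<^sup>1 (B Z)\<close> for a standard normal \<open>Z\<close>, where \<open>B = M\<^sup>T A\<close> and \<open>V = A A\<^sup>T\<close>.  This is the squared
  norm of the projection of \<open>Z\<close> onto the \<open>r\<close>-dimensional row space of \<open>B\<close>.  Rotating that space onto
  \<open>r\<close> coordinate axes preserves the law of \<open>Z\<close> and turns the norm into a sum of \<open>r\<close> squared independent
  standard normals.
\<close>

subsection \<open>Continuity and measurability of the matrix inverse\<close>

lemma matrix_inv_invertible: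
  fixes A :: "real ^ 'n ^ 'n"
  assumes "invertible A"
  shows "A ** matrix_inv A = mat 1" "matrix_inv A ** A = mat 1"
proof -
  have "A ** matrix_inv A = mat 1 \<and> matrix_inv A ** A = mat 1"
    unfolding matrix_inv_def using assms unfolding invertible_def by (rule someI_ex)
  then show "A ** matrix_inv A = mat 1" "matrix_inv A ** A = mat 1" by auto
qed

text \<open>Column \<open>j\<close> of the inverse solves \<open>A *v x = axis j 1\<close>, so
  Cramer's rule yields it. The gain is an explicit quotient of polynomials in the entries of
  \<open>A\<close>, from which continuity can be read off.\<close>

lemma matrix_inv_cramer:
  fixes A :: "real ^ 'n ^ 'n"
  assumes "invertible A"
  shows "matrix_inv A $ i $ j =
    det (\<chi> k l. if l = i then axis j 1 $ k else A $ k $ l) / det A"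
proof -
  have "A *v (matrix_inv A *v axis j 1) = axis j 1"
    by (simp add: matrix_vector_mul_assoc matrix_inv_invertible[OF assms])
  moreover have "det A \<noteq> 0"
    using assms invertible_det_nz by blast
  ultimately have "matrix_inv A *v axis j 1 =
      (\<chi> i. det (\<chi> k l. if l = i then axis j 1 $ k else A $ k $ l) / det A)"
    using cramer by blast
  moreover have "(matrix_inv A *v axis j 1) $ i = matrix_inv A $ i $ j"
    by (simp add: matrix_vector_mult_basis column_def)
  ultimately show ?thesis by simp
qed

lemma continuous_det [continuous_intros]:
  fixes f :: "'a :: t2_space \<Rightarrow> real ^ 'n ^ 'n"
  assumes "continuous F f"
  shows "continuous F (\<lambda>x. det (f x))"
  unfolding det_def using assms by (intro continuous_intros)

text \<open>Nonvanishing of the determinant is an open condition, so on a whole neighbourhood of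
  \<open>A\<close> the inverse coincides with the Cramer quotient. That quotient is continuous at
  \<open>A\<close> because its denominator is nonzero there.\<close>

lemma isCont_matrix_inv:
  fixes A :: "real ^ 'n ^ 'n"
  assumes "invertible A"
  shows "isCont matrix_inv A"
proof -
  have nz: "det A \<noteq> 0"
    using assms invertible_det_nz by blast
  have "open {B :: real ^ 'n ^ 'n. det B \<noteq> 0}"
    by (intro open_Collect_neq continuous_on_const)
      (auto intro: continuous_at_imp_continuous_on continuous_det[OF continuous_ident])
  then have "\<forall>\<^sub>F B in nhds A. det B \<noteq> 0"
    using nz eventually_nhds_in_open by fastforce
  then have ev: "\<forall>\<^sub>F B in nhds A. matrix_inv B =
      (\<chi> i j. det (\<chi> k l. if l = i then axis j 1 $ k else B $ k $ l) / det B)"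
    by (rule eventually_mono) (auto simp: vec_eq_iff matrix_inv_cramer invertible_det_nz)
  have "isCont (\<lambda>B. \<chi> i j. det (\<chi> k l. if l = i then axis j 1 $ k else B $ k $ l) / det B) A"
  proof -
    have "isCont (\<lambda>B. \<chi> k l. if l = i then axis j 1 $ k else B $ k $ l) A" for i j
      unfolding isCont_def
    proof (intro vec_tendstoI)
      fix k l
      show "((\<lambda>B. (\<chi> k l. if l = i then axis j 1 $ k else B $ k $ l) $ k $ l) \<longlongrightarrow>
          (\<chi> k l. if l = i then axis j 1 $ k else A $ k $ l) $ k $ l) (at A)"
        by (cases "l = i") (auto intro!: tendsto_intros)
    qed
    then have "isCont (\<lambda>B. det (\<chi> k l. if l = i then axis j 1 $ k else B $ k $ l)) A" for i j
      by (rule continuous_det)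
    moreover have "isCont (\<lambda>B. det B) A"
      by (rule continuous_det[OF continuous_ident])
    ultimately have "isCont (\<lambda>B. det (\<chi> k l. if l = i then axis j 1 $ k else B $ k $ l) / det B) A" for i j
      using nz unfolding isCont_def by (intro tendsto_divide)
    then show ?thesis
      unfolding isCont_def by (intro vec_tendstoI) simp
  qed
  then show ?thesis
    using ev isCont_cong by force
qed

text \<open>The inverse is continuous on the open set \<open>S\<close> of invertible matrices and
  constant off it: for a singular matrix the predicate under the choice operator is identically
  false, so the choice always returns the same \<open>C\<close>. Measurability on the whole space is
  needed because estimated matrices may be singular on some outcomes.\<close>

lemma borel_measurable_matrix_inv [measurable]:
  "(matrix_inv :: real ^ 'n ^ 'n \<Rightarrow> real ^ 'n ^ 'n) \<in> borel_measurable borel"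
proof -
  define S where "S = {A :: real ^ 'n ^ 'n. det A \<noteq> 0}"
  define C where "C = (SOME B :: real ^ 'n ^ 'n. False)"
  have "open S"
    unfolding S_def by (intro open_Collect_neq continuous_on_const)
      (auto intro: continuous_at_imp_continuous_on continuous_det[OF continuous_ident])
  have "continuous_on S (matrix_inv :: real ^ 'n ^ 'n \<Rightarrow> real ^ 'n ^ 'n)"
    by (auto intro!: continuous_at_imp_continuous_on isCont_matrix_inv simp: S_def invertible_det_nz)
  then have "(\<lambda>A. if A \<in> S then matrix_inv A else C) \<in> borel_measurable borel"
    using \<open>open S\<close> by (intro borel_measurable_continuous_on_if) auto
  moreover have "(if A \<in> S then matrix_inv A else C) = matrix_inv A" for A :: "real ^ 'n ^ 'n"
  proof (cases "A \<in> S")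
    case False
    then have "(\<lambda>B. A ** B = mat 1 \<and> B ** A = mat 1) = (\<lambda>_. False)"
      unfolding S_def mem_Collect_eq invertible_det_nz[symmetric] invertible_def by blast
    with False show ?thesis by (simp add: C_def matrix_inv_def)
  qed simp
  ultimately show ?thesis by simp
qed

subsection \<open>Convergence in probability and tightness\<close>

lemma LIMSEQ_0_squeeze:
  fixes a b :: "nat \<Rightarrow> real"
  assumes "\<And>n. 0 \<le> a n" "\<And>n. a n \<le> b n" "b \<longlonglongrightarrow> 0"
  shows "a \<longlonglongrightarrow> 0"
  using assms by (intro tendsto_sandwich[of "\<lambda>_. 0" a sequentially b]) auto

lemma tendsto_in_prob_isCont:
  fixes X :: "nat \<Rightarrow> 'a \<Rightarrow> 'b :: {metric_space, second_countable_topology}"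
    and g :: "'b \<Rightarrow> 'c :: metric_space"
  assumes "prob_space P" and X: "tendsto_in_prob P X c"
    and [measurable]: "\<And>n. X n \<in> borel_measurable P"
    and "isCont g c"
  shows "tendsto_in_prob P (\<lambda>n \<omega>. g (X n \<omega>)) (g c)"
  unfolding tendsto_in_prob_def
proof (intro allI impI)
  fix \<epsilon> :: real assume "\<epsilon> > 0"
  interpret prob_space P by fact
  obtain \<delta> where \<delta>: "\<delta> > 0" "\<And>a. dist a c < \<delta> \<Longrightarrow> dist (g a) (g c) < \<epsilon>"
    using assms(4) \<open>\<epsilon> > 0\<close> unfolding continuous_at_eps_delta by blast
  \<comment> \<open>Continuity excludes only distances below \<open>\<delta>\<close>, which leaves
    \<open>dist (X n \<omega>) c \<ge> \<delta>\<close>. Halving \<open>\<delta>\<close> gives the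
    strict inequality in the definition of \<open>tendsto_in_prob\<close>.\<close>
  have "{\<omega> \<in> space P. dist (g (X n \<omega>)) (g c) > \<epsilon>} \<subseteq> {\<omega> \<in> space P. dist (X n \<omega>) c > \<delta> / 2}" for n
    proof (intro subsetI CollectI conjI)
    fix \<omega> assume \<omega>: "\<omega> \<in> {\<omega> \<in> space P. dist (g (X n \<omega>)) (g c) > \<epsilon>}"
    then show "\<omega> \<in> space P" by simp
    have "\<not> dist (X n \<omega>) c < \<delta>"
      using \<delta>(2)[of "X n \<omega>"] \<omega> by auto
    then show "dist (X n \<omega>) c > \<delta> / 2" using \<delta>(1) by linarith
  qed
  then have "prob {\<omega> \<in> space P. dist (g (X n \<omega>)) (g c) > \<epsilon>} \<le> prob {\<omega> \<in> space P. dist (X n \<omega>) c > \<delta> / 2}" for n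
    by (intro finite_measure_mono) auto
  moreover have "(\<lambda>n. prob {\<omega> \<in> space P. dist (X n \<omega>) c > \<delta> / 2}) \<longlonglongrightarrow> 0"
    using X half_gt_zero[OF \<delta>(1)] unfolding tendsto_in_prob_def by blast
  ultimately show "(\<lambda>n. prob {\<omega> \<in> space P. dist (g (X n \<omega>)) (g c) > \<epsilon>}) \<longlonglongrightarrow> 0"
    by (rule LIMSEQ_0_squeeze[OF measure_nonneg])
qed

text \<open>The product distance is at most the sum of the two distances, so if it exceeds
  \<open>\<epsilon>\<close>, one of them exceeds \<open>\<epsilon> / 2\<close>. The union bound then
  works whatever the dependence between \<open>X n\<close> and \<open>Y n\<close>.\<close>

lemma tendsto_in_prob_Pair:
  fixes X :: "nat \<Rightarrow> 'a \<Rightarrow> 'b :: {metric_space, second_countable_topology}"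
    and Y :: "nat \<Rightarrow> 'a \<Rightarrow> 'c :: {metric_space, second_countable_topology}"
  assumes "prob_space P" and X: "tendsto_in_prob P X c" and Y: "tendsto_in_prob P Y d"
    and [measurable]: "\<And>n. X n \<in> borel_measurable P" "\<And>n. Y n \<in> borel_measurable P"
  shows "tendsto_in_prob P (\<lambda>n \<omega>. (X n \<omega>, Y n \<omega>)) (c, d)"
  unfolding tendsto_in_prob_def
proof (intro allI impI)
  fix \<epsilon> :: real assume "\<epsilon> > 0"
  interpret prob_space P by fact
  let ?X = "\<lambda>n. {\<omega> \<in> space P. dist (X n \<omega>) c > \<epsilon> / 2}"
  let ?Y = "\<lambda>n. {\<omega> \<in> space P. dist (Y n \<omega>) d > \<epsilon> / 2}"
  let ?XY = "\<lambda>n. {\<omega> \<in> space P. dist (X n \<omega>, Y n \<omega>) (c, d) > \<epsilon>}"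
  have le: "dist (a, b) (c, d) \<le> dist a c + dist b d" for a b
    unfolding dist_Pair_Pair by (rule sqrt_sum_squares_le_sum) auto
  have "?XY n \<subseteq> ?X n \<union> ?Y n" for n
  proof
    fix \<omega> assume "\<omega> \<in> ?XY n"
    with le[of "X n \<omega>" "Y n \<omega>"] show "\<omega> \<in> ?X n \<union> ?Y n" by auto
  qed
  then have "prob (?XY n) \<le> prob (?X n \<union> ?Y n)" for n
    by (intro finite_measure_mono) auto
  also have "prob (?X n \<union> ?Y n) \<le> prob (?X n) + prob (?Y n)" for n
    by (intro measure_subadditive) auto
  finally have "prob (?XY n) \<le> prob (?X n) + prob (?Y n)" for n .
  moreover have "(\<lambda>n. prob (?X n) + prob (?Y n)) \<longlonglongrightarrow> 0"
    using X Y half_gt_zero[OF \<open>\<epsilon> > 0\<close>] unfolding tendsto_in_prob_def by (intro tendsto_add_zero) blast+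
  ultimately show "(\<lambda>n. prob (?XY n)) \<longlonglongrightarrow> 0"
    by (rule LIMSEQ_0_squeeze[OF measure_nonneg])
qed

text \<open>The limit law has a small tail beyond some \<open>k\<close> by continuity from above.
  Weak convergence transfers only integrals of bounded continuous functions, so the tail indicators
  are separated by a continuous ramp, at the cost of enlarging the radius from \<open>k\<close> to
  \<open>k + 1\<close>.\<close>

lemma tight_of_weak_conv:
  fixes Z :: "nat \<Rightarrow> 'a \<Rightarrow> 'b :: euclidean_space"
  assumes P: "prob_space P" and [measurable]: "\<And>n. Z n \<in> borel_measurable P"
    and N: "prob_space N" and [measurable_cong]: "sets N = sets borel"
    and conv: "weak_conv_measures (\<lambda>n. distr P borel (Z n)) N" and "\<epsilon> > 0"
  obtains K where "K > 0" "\<forall>\<^sub>F n in sequentially. measure P {\<omega> \<in> space P. norm (Z n \<omega>) > K} < \<epsilon>"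
proof -
  interpret P: prob_space P by fact
  interpret N: prob_space N by fact
  have sp: "space N = UNIV" using sets_eq_imp_space_eq[OF assms(4)] by simp
  have "(\<lambda>k. N.prob {x. norm x > real k}) \<longlonglongrightarrow> N.prob (\<Inter>k. {x. norm x > real k})"
    by (intro N.finite_Lim_measure_decseq) (auto simp: decseq_def)
  also have "(\<Inter>k. {x :: 'b. norm x > real k}) = {}"
  proof (intro equals0I, clarsimp)
    fix x :: 'b assume "\<forall>k. real k < norm x"
    moreover obtain k where "norm x < real k" using reals_Archimedean2 by blast
    ultimately show False using less_asym by blast
  qed
  finally have "(\<lambda>k. N.prob {x. norm x > real k}) \<longlonglongrightarrow> 0" by simp
  then have "\<forall>\<^sub>F k in sequentially. N.prob {x. norm x > real k} < \<epsilon>"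
    using \<open>\<epsilon> > 0\<close> by (rule order_tendstoD(2))
  then obtain k where k: "N.prob {x. norm x > real k} < \<epsilon>"
    using eventually_happens'[OF sequentially_bot] by blast
  \<comment> \<open>The ramp is 0 where the norm is at most \<open>k\<close> and 1 where it is at
    least \<open>k + 1\<close>. It thus lies below the indicator of norm above \<open>k\<close>,
    used under \<open>N\<close>, and above the indicator of norm above \<open>k + 1\<close>, used
    under \<open>P\<close>.\<close>
  define f :: "'b \<Rightarrow> real" where "f x = min 1 (max 0 (norm x - real k))" for x
  have f: "continuous_on UNIV f" unfolding f_def by (intro continuous_intros)
  have fm [measurable]: "f \<in> borel_measurable borel" by (rule borel_measurable_continuous_onI[OF f])
  have f01: "0 \<le> f x" "f x \<le> 1" for x by (auto simp: f_def)
  have "bounded (range f)" by (rule boundedI[of _ 1]) (auto simp: f_def)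
  with conv f have "(\<lambda>n. \<integral>x. f x \<partial>distr P borel (Z n)) \<longlonglongrightarrow> (\<integral>x. f x \<partial>N)"
    unfolding weak_conv_measures_def by blast
  then have lim: "(\<lambda>n. \<integral>\<omega>. f (Z n \<omega>) \<partial>P) \<longlonglongrightarrow> (\<integral>x. f x \<partial>N)"
    by (simp add: integral_distr)
  have "(\<integral>x. f x \<partial>N) \<le> (\<integral>x. indicator {x. norm x > real k} x \<partial>N)"
    using f01 by (intro integral_mono N.integrable_const_bound[of _ 1])
      (auto simp: f_def split: split_indicator)
  also have "\<dots> < \<epsilon>" using k by (simp add: sp)
  finally have "\<forall>\<^sub>F n in sequentially. (\<integral>\<omega>. f (Z n \<omega>) \<partial>P) < \<epsilon>"
    using lim order_tendstoD(2) by blast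
  moreover have "P.prob {\<omega> \<in> space P. norm (Z n \<omega>) > real k + 1} \<le> (\<integral>\<omega>. f (Z n \<omega>) \<partial>P)" for n
  proof -
    have "P.prob {\<omega> \<in> space P. norm (Z n \<omega>) > real k + 1}
        = (\<integral>\<omega>. indicator {\<omega> \<in> space P. norm (Z n \<omega>) > real k + 1} \<omega> \<partial>P)"
      by (simp add: Int_def conj_commute)
    also have "\<dots> \<le> (\<integral>\<omega>. f (Z n \<omega>) \<partial>P)"
      using f01 by (intro integral_mono P.integrable_const_bound[of _ 1])
        (auto simp: f_def split: split_indicator)
    finally show ?thesis .
  qed
  ultimately have "\<forall>\<^sub>F n in sequentially. P.prob {\<omega> \<in> space P. norm (Z n \<omega>) > real k + 1} < \<epsilon>"
    by (auto elim!: eventually_mono intro: le_less_trans)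
  then show thesis by (intro that[of "real k + 1"]) auto
qed

subsection \<open>The standard multivariate normal law and chi-square\<close>

lemma prob_space_std_normal: "prob_space (density lborel std_normal_density)"
  by (rule prob_space_normal_density) simp

text \<open>Both the normal density and Lebesgue measure factor over the coordinates, so the
  integral of a product is a product of integrals. This encodes the independence of the
  coordinates.\<close>

lemma nn_integral_std_mv_normal_prod:
  fixes g :: "'n :: finite \<Rightarrow> real \<Rightarrow> ennreal"
  assumes [measurable]: "\<And>i. g i \<in> borel_measurable borel" and fin: "\<And>i x. g i x < \<top>"
  shows "(\<integral>\<^sup>+z. (\<Prod>i\<in>UNIV. g i (z $ i)) \<partial>(std_mv_normal :: (real ^ 'n) measure))
    = (\<Prod>i\<in>UNIV. \<integral>\<^sup>+x. g i x \<partial>density lborel std_normal_density)"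
proof -
  \<comment> \<open>The product formula for \<open>lborel\<close> indexes its factors by basis
    vectors; \<open>a\<close> reads the coordinate back from a basis vector.\<close>
  define a :: "real ^ 'n \<Rightarrow> 'n" where "a = (\<lambda>b. THE i. b = axis i 1)"
  have a [simp]: "a (axis i 1) = i" for i by (auto simp: a_def axis_eq_axis)
  have B: "(Basis :: (real ^ 'n) set) = (\<lambda>i. axis i 1) ` UNIV" by (auto simp: Basis_vec_def)
  have inj: "inj (\<lambda>i :: 'n. axis i (1 :: real))" by (auto simp: inj_def axis_eq_axis)
  \<comment> \<open>The factors have to be real-valued there. Since \<open>g\<close> is finite, the
    passage through \<open>enn2real\<close> loses nothing.\<close>
  define f where "f b x = enn2real (g (a b) x) * std_normal_density x" for b x
  have f [measurable]: "f b \<in> borel_measurable borel" for b unfolding f_def by measurable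
  have fg: "ennreal (f (axis i 1) x) = ennreal (std_normal_density x) * g i x" for i x
    using fin[of i x] by (simp add: f_def ennreal_mult mult.commute)
  have "(\<integral>\<^sup>+z. (\<Prod>i\<in>UNIV. g i (z $ i)) \<partial>(std_mv_normal :: (real ^ 'n) measure))
    = (\<integral>\<^sup>+z. (\<Prod>i\<in>UNIV. std_normal_density (z $ i)) * (\<Prod>i\<in>UNIV. g i (z $ i)) \<partial>lborel)"
    unfolding std_mv_normal_def by (subst nn_integral_density) auto
  also have "\<dots> = nn_integral lborel (\<lambda>z :: real ^ 'n. \<Prod>i\<in>UNIV. ennreal (f (axis i 1) (z \<bullet> axis i 1)))"
  proof (rule arg_cong[where f = "nn_integral lborel"], rule ext)
    fix z :: "real ^ 'n"
    have "ennreal (\<Prod>i\<in>UNIV. std_normal_density (z $ i)) = (\<Prod>i\<in>UNIV. ennreal (std_normal_density (z $ i)))"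
      by (rule prod_ennreal[symmetric]) simp
    then show "ennreal (\<Prod>i\<in>UNIV. std_normal_density (z $ i)) * (\<Prod>i\<in>UNIV. g i (z $ i))
        = (\<Prod>i\<in>UNIV. ennreal (f (axis i 1) (z \<bullet> axis i 1)))"
      by (simp only: fg prod.distrib inner_axis) simp
  qed
  also have "\<dots> = (\<integral>\<^sup>+z. (\<Prod>b\<in>Basis. ennreal (f b (z \<bullet> b))) \<partial>lborel)"
    unfolding B by (simp add: prod.reindex inj)
  also have "\<dots> = (\<Prod>b\<in>Basis. \<integral>\<^sup>+x. f b x \<partial>lborel)"
    by (subst nn_integral_lborel_prod[symmetric]) (auto simp: f_def prod_ennreal)
  also have "\<dots> = (\<Prod>i\<in>UNIV. \<integral>\<^sup>+x. f (axis i 1) x \<partial>lborel)"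
    unfolding B by (simp add: prod.reindex inj)
  also have "\<dots> = (\<Prod>i\<in>UNIV. \<integral>\<^sup>+x. g i x \<partial>density lborel std_normal_density)"
    by (subst nn_integral_density) (auto simp: fg)
  finally show ?thesis .
qed

lemma sets_std_mv_normal [simp, measurable_cong]: "sets std_mv_normal = sets borel"
  by (simp add: std_mv_normal_def)

lemma space_std_mv_normal [simp]: "space std_mv_normal = UNIV"
  by (simp add: std_mv_normal_def)

text \<open>A product measure is determined by its values on boxes, and the indicator of a box is a
  product of coordinate indicators, to which the product formula applies.\<close>

lemma distr_std_mv_normal_vec_nth:
  "distr std_mv_normal (Pi\<^sub>M UNIV (\<lambda>_. borel)) (\<lambda>z :: real ^ 'n. ($) z)
    = Pi\<^sub>M UNIV (\<lambda>_. density lborel std_normal_density)"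
proof -
  interpret N: prob_space "density lborel std_normal_density" by (rule prob_space_std_normal)
  interpret product_sigma_finite "\<lambda>_ :: 'n. density lborel std_normal_density" ..
  have [measurable]: "(\<lambda>z :: real ^ 'n. ($) z) \<in> std_mv_normal \<rightarrow>\<^sub>M Pi\<^sub>M UNIV (\<lambda>_. borel)"
    by (rule measurable_PiM_single') auto
  show ?thesis
  proof (rule PiM_eqI)
    show "sets (distr std_mv_normal (Pi\<^sub>M UNIV (\<lambda>_. borel)) (\<lambda>z :: real ^ 'n. ($) z))
        = sets (Pi\<^sub>M UNIV (\<lambda>_. density lborel std_normal_density))"
      by (simp cong: sets_PiM_cong)
  next
    fix A :: "'n \<Rightarrow> real set"
    assume "\<And>i. i \<in> UNIV \<Longrightarrow> A i \<in> sets (density lborel std_normal_density)"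
    then have A [measurable]: "A i \<in> sets borel" for i by simp
    have S [measurable]: "Pi\<^sub>E UNIV A \<in> sets (Pi\<^sub>M UNIV (\<lambda>_. borel))"
      by (rule sets_PiM_I_finite) auto
    have "emeasure (distr std_mv_normal (Pi\<^sub>M UNIV (\<lambda>_. borel)) (\<lambda>z :: real ^ 'n. ($) z)) (Pi\<^sub>E UNIV A)
        = (\<integral>\<^sup>+z. indicator (Pi\<^sub>E UNIV A) (($) z) \<partial>std_mv_normal)"
      using S by (subst nn_integral_indicator[symmetric], simp, subst nn_integral_distr) auto
    also have "\<dots> = (\<integral>\<^sup>+z. (\<Prod>i\<in>UNIV. indicator (A i) (z $ i)) \<partial>std_mv_normal)"
    proof (rule nn_integral_cong)
      fix z :: "real ^ 'n"
      show "indicator (Pi\<^sub>E UNIV A) (($) z) = (\<Prod>i\<in>UNIV. indicator (A i) (z $ i) :: ennreal)"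
      proof (cases "\<forall>i. z $ i \<in> A i")
        case False
        then obtain i where "z $ i \<notin> A i" by auto
        then have "(\<Prod>i\<in>UNIV. indicator (A i) (z $ i) :: ennreal) = 0"
          by (intro prod_zero) (auto intro!: exI[of _ i])
        with False show ?thesis by (auto simp: PiE_iff)
      qed (auto simp: PiE_iff)
    qed
    also have "\<dots> = (\<Prod>i\<in>UNIV. \<integral>\<^sup>+x. indicator (A i) x \<partial>density lborel std_normal_density)"
      by (rule nn_integral_std_mv_normal_prod) (auto split: split_indicator)
    finally show "emeasure (distr std_mv_normal (Pi\<^sub>M UNIV (\<lambda>_. borel)) (\<lambda>z :: real ^ 'n. ($) z)) (Pi\<^sub>E UNIV A)
        = (\<Prod>i\<in>UNIV. emeasure (density lborel std_normal_density) (A i))"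
      by simp
  qed simp
qed

lemma prob_space_std_mv_normal: "prob_space (std_mv_normal :: (real ^ 'n) measure)"
proof
  interpret N: prob_space "density lborel std_normal_density" by (rule prob_space_std_normal)
  have "emeasure (std_mv_normal :: (real ^ 'n) measure) UNIV = (\<integral>\<^sup>+z. (\<Prod>i\<in>UNIV. (\<lambda>_ _. 1) i (z $ i)) \<partial>(std_mv_normal :: (real ^ 'n) measure))"
    by simp
  also have "\<dots> = 1"
    by (subst nn_integral_std_mv_normal_prod) (use N.emeasure_space_1 in auto)
  finally show "emeasure (std_mv_normal :: (real ^ 'n) measure) (space std_mv_normal) = 1" by simp
qed

text \<open>Since \<open>e\<close> is injective, the selected coordinates are distinct and hence
  again independent standard normals. Reindexing the full product measure along \<open>e\<close>
  gives the product in the definition of \<open>chi_square\<close>.\<close>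

lemma distr_std_mv_normal_sum_squares:
  assumes e: "inj_on e {..<r}"
  shows "distr std_mv_normal borel (\<lambda>z :: real ^ 'n. \<Sum>i<r. (z $ e i)\<^sup>2) = chi_square r"
proof -
  let ?N = "density lborel std_normal_density :: real measure"
  have [measurable]: "(\<lambda>z :: real ^ 'n. ($) z) \<in> std_mv_normal \<rightarrow>\<^sub>M Pi\<^sub>M UNIV (\<lambda>_. borel)"
    by (rule measurable_PiM_single') auto
  have "Pi\<^sub>M {..<r} (\<lambda>_. ?N) = distr (Pi\<^sub>M UNIV (\<lambda>_. ?N)) (Pi\<^sub>M {..<r} (\<lambda>_. ?N)) (\<lambda>\<omega>. \<lambda>i\<in>{..<r}. \<omega> (e i))"
    using distr_PiM_reindex[of UNIV "\<lambda>_. ?N" e "{..<r}"] prob_space_std_normal e by simp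
  also have "\<dots> = distr (distr std_mv_normal (Pi\<^sub>M UNIV (\<lambda>_. borel)) (\<lambda>z :: real ^ 'n. ($) z))
      (Pi\<^sub>M {..<r} (\<lambda>_. ?N)) (\<lambda>\<omega>. \<lambda>i\<in>{..<r}. \<omega> (e i))"
    by (simp add: distr_std_mv_normal_vec_nth)
  also have "\<dots> = distr std_mv_normal (Pi\<^sub>M {..<r} (\<lambda>_. ?N)) (\<lambda>z :: real ^ 'n. \<lambda>i\<in>{..<r}. z $ e i)"
    by (subst distr_distr) (auto simp: comp_def)
  finally have "chi_square r = distr (distr std_mv_normal (Pi\<^sub>M {..<r} (\<lambda>_. ?N)) (\<lambda>z :: real ^ 'n. \<lambda>i\<in>{..<r}. z $ e i))
      borel (\<lambda>z. \<Sum>i<r. (z i)\<^sup>2)"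
    by (simp add: chi_square_def)
  also have "\<dots> = distr std_mv_normal borel (\<lambda>z :: real ^ 'n. \<Sum>i<r. (z $ e i)\<^sup>2)"
    by (subst distr_distr) (auto simp: comp_def intro!: distr_cong)
  finally show ?thesis ..
qed

section \<open>Rotation invariance of Lebesgue measure and of the normal law\<close>

lemma nn_integral_lborel_translation:
  fixes g :: "'a :: euclidean_space \<Rightarrow> ennreal"
  assumes "g \<in> borel_measurable borel"
  shows "(\<integral>\<^sup>+x. g (c + x) \<partial>lborel) = (\<integral>\<^sup>+x. g x \<partial>lborel)"
proof -
  have "(\<integral>\<^sup>+x. g x \<partial>distr lborel borel ((+) c)) = (\<integral>\<^sup>+x. g (c + x) \<partial>lborel)"
    using assms by (subst nn_integral_distr) auto
  then show ?thesis by (simp add: lborel_distr_plus)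
qed

lemma borel_measurable_orthogonal_transformation:
  fixes f :: "'a :: euclidean_space \<Rightarrow> 'a"
  assumes "orthogonal_transformation f"
  shows "f \<in> borel_measurable borel"
  using orthogonal_transformation_linear[OF assms]
  by (intro borel_measurable_continuous_onI linear_continuous_on linear_conv_bounded_linear[THEN iffD1])

text \<open>
  The library's rotation invariance of Lebesgue measure needs a well-ordered index type.  Here it
  comes from uniqueness of Haar measure: for the unit ball \<open>A\<close>, evaluating
  \<open>\<integral>\<integral> 1\<^sub>A(x) 1\<^sub>B(x + f y)\<close> in both orders gives \<open>\<lambda>(A) \<cdot> (f\<^sub>* \<lambda>)(B)\<close> and \<open>\<lambda>(A) \<cdot> \<lambda>(B)\<close>.
\<close>
lemma distr_lborel_orthogonal_transformation:
  fixes f :: "'a :: euclidean_space \<Rightarrow> 'a"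
  assumes f: "orthogonal_transformation f"
  shows "distr lborel borel f = lborel"
proof (rule measure_eqI)
  fix B :: "'a set" assume "B \<in> sets (distr lborel borel f)"
  then have [measurable]: "B \<in> sets borel" by simp
  note borel_measurable_orthogonal_transformation[OF f, measurable]
  have lin: "linear f" by (rule orthogonal_transformation_linear[OF f])
  \<comment> \<open>A translation by \<open>x\<close> in the image of \<open>f\<close> is a
    translation by \<open>inv f x\<close> in its domain, so invariance of \<open>lborel\<close> can
    be used on either side of \<open>f\<close>.\<close>
  have shift: "f (inv f x + y) = x + f y" for x y
    using orthogonal_transformation_surj[OF f] by (simp add: linear_add[OF lin] surj_f_inv_f)
  let ?A = "ball (0 :: 'a) 1"
  have [measurable]: "?A \<in> sets borel" by simp
  \<comment> \<open>This is where \<open>f\<close> being an isometry enters: as a condition on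
    \<open>y\<close>, membership in the ball describes a unit ball about \<open>inv f x\<close>,
    whose volume is that of \<open>?A\<close> for every \<open>x\<close>.\<close>
  have ball: "indicator ?A (- f y + x) = (indicator (ball (inv f x) 1) y :: ennreal)" for x y
  proof -
    have "norm (- f y + x) = norm (f (inv f x - y))"
      using orthogonal_transformation_surj[OF f] by (simp add: linear_diff[OF lin] surj_f_inv_f)
    then show ?thesis
      using f by (simp add: indicator_def orthogonal_transformation_norm dist_norm norm_minus_commute)
  qed
  \<comment> \<open>The volume of the ball has to be finite and nonzero for it to be cancelled at
    the end.\<close>
  have finA: "emeasure lborel ?A < \<infinity>" by (rule emeasure_bounded_finite) auto
  have posA: "emeasure lborel ?A \<noteq> 0"
    by (simp add: emeasure_ball unit_ball_vol_pos less_imp_neq[symmetric])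
  have distr: "(\<integral>\<^sup>+y. indicator B (f y) \<partial>lborel) = emeasure (distr lborel borel f) B"
    by (subst nn_integral_indicator[symmetric], simp, subst nn_integral_distr) auto
  have "emeasure lborel ?A * emeasure (distr lborel borel f) B
      = (\<integral>\<^sup>+x. indicator ?A x * (\<integral>\<^sup>+y. indicator B (f y) \<partial>lborel) \<partial>lborel)"
    unfolding distr by (subst nn_integral_multc) (auto intro!: borel_measurable_indicator)
  also have "\<dots> = (\<integral>\<^sup>+x. indicator ?A x * (\<integral>\<^sup>+y. indicator B (x + f y) \<partial>lborel) \<partial>lborel)"
  proof (rule nn_integral_cong)
    fix x
    show "indicator ?A x * (\<integral>\<^sup>+y. indicator B (f y) \<partial>lborel)
        = (indicator ?A x * (\<integral>\<^sup>+y. indicator B (x + f y) \<partial>lborel) :: ennreal)"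
      using nn_integral_lborel_translation[of "\<lambda>y. indicator B (f y)" "inv f x"] by (simp add: shift)
  qed
  also have "\<dots> = (\<integral>\<^sup>+x. \<integral>\<^sup>+y. indicator ?A x * indicator B (x + f y) \<partial>lborel \<partial>lborel)"
    by (simp add: nn_integral_cmult)
  also have "\<dots> = (\<integral>\<^sup>+y. \<integral>\<^sup>+x. indicator ?A x * indicator B (x + f y) \<partial>lborel \<partial>lborel)"
    by (rule lborel_pair.Fubini') simp
  also have "\<dots> = (\<integral>\<^sup>+y. \<integral>\<^sup>+x. indicator ?A (- f y + x) * indicator B x \<partial>lborel \<partial>lborel)"
  proof (rule nn_integral_cong)
    fix y
    show "(\<integral>\<^sup>+x. indicator ?A x * indicator B (x + f y) \<partial>lborel)
        = (\<integral>\<^sup>+x. indicator ?A (- f y + x) * indicator B x \<partial>lborel)"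
      using nn_integral_lborel_translation[of "\<lambda>x. indicator ?A x * indicator B (x + f y)" "- f y"] by simp
  qed
  also have "\<dots> = (\<integral>\<^sup>+x. \<integral>\<^sup>+y. indicator ?A (- f y + x) * indicator B x \<partial>lborel \<partial>lborel)"
    by (rule lborel_pair.Fubini') simp
  also have "\<dots> = (\<integral>\<^sup>+x. emeasure lborel ?A * indicator B x \<partial>lborel)"
    unfolding ball by (subst nn_integral_multc) (auto simp: emeasure_ball intro!: borel_measurable_indicator)
  also have "\<dots> = emeasure lborel ?A * emeasure lborel B"
    by (simp add: nn_integral_cmult)
  finally show "emeasure (distr lborel borel f) B = emeasure lborel B"
    using finA posA by (auto simp: ennreal_mult_cancel_left)
qed simp

lemma prod_std_normal_density:
  fixes z :: "real ^ 'n"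
  shows "(\<Prod>i\<in>UNIV. std_normal_density (z $ i)) = (1 / sqrt (2 * pi)) ^ CARD('n) * exp (- (norm z)\<^sup>2 / 2)"
proof -
  have "(norm z)\<^sup>2 = (\<Sum>i\<in>UNIV. (z $ i)\<^sup>2)"
    by (simp add: norm_vec_def L2_set_def sum_nonneg)
  then have "exp (- (norm z)\<^sup>2 / 2) = (\<Prod>i\<in>UNIV. exp (- (z $ i)\<^sup>2 / 2))"
    by (simp add: exp_sum[symmetric] sum_negf sum_divide_distrib)
  then show ?thesis
    by (simp only: std_normal_density_def prod.distrib) simp
qed

text \<open>The density depends on \<open>z\<close> only through its norm, so it is unchanged by
  \<open>f\<close>, and so is Lebesgue measure.\<close>

lemma distr_std_mv_normal_orthogonal_transformation:
  fixes f :: "real ^ 'n \<Rightarrow> real ^ 'n"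
  assumes f: "orthogonal_transformation f"
  shows "distr std_mv_normal borel f = std_mv_normal"
proof -
  have fm [measurable]: "f \<in> borel_measurable borel"
    by (rule borel_measurable_orthogonal_transformation[OF f])
  define h :: "real ^ 'n \<Rightarrow> ennreal" where "h z = ennreal (\<Prod>i\<in>UNIV. std_normal_density (z $ i))" for z
  have [measurable]: "h \<in> borel_measurable borel" unfolding h_def by measurable
  have h: "h (f z) = h z" for z
    using f by (simp add: h_def prod_std_normal_density orthogonal_transformation_norm)
  have "density (distr lborel borel f) h = distr (density lborel (\<lambda>z. h (f z))) borel f"
    by (rule density_distr) auto
  moreover have "std_mv_normal = density lborel h"
    unfolding std_mv_normal_def h_def ..
  ultimately show ?thesis
    by (simp only: distr_lborel_orthogonal_transformation[OF f] h)
qed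

text \<open>The hypotheses make \<open>p\<close> the orthogonal projection onto its range
  \<open>S\<close>. Equal dimensions provide isometries from \<open>S\<close> onto the coordinate
  subspace \<open>T\<close> of \<open>R\<close> and from the complement \<open>S'\<close> onto the
  complementary coordinate subspace \<open>T'\<close>. Applying them to \<open>p x\<close> and
  \<open>x - p x\<close> and adding gives an isometry by Pythagoras, and the coordinates of
  \<open>f x\<close> in \<open>R\<close> come from \<open>p x\<close> alone.\<close>

lemma orthogonal_transformation_projection_to_coordinates:
  fixes p :: "real ^ 'n \<Rightarrow> real ^ 'n" and R :: "'n set"
  assumes p: "linear p" and orth: "\<And>x y. orthogonal (p y) (x - p x)"
    and R: "dim (range p) = card R"
  obtains f where "orthogonal_transformation f" "\<And>x. (norm (p x))\<^sup>2 = (\<Sum>i\<in>R. (f x $ i)\<^sup>2)"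
proof -
  define S where "S = range p"
  define S' where "S' = {y \<in> UNIV. \<forall>x\<in>S. orthogonal x y}"
  define T where "T = {x :: real ^ 'n. \<forall>i. i \<notin> R \<longrightarrow> x $ i = 0}"
  define T' where "T' = {x :: real ^ 'n. \<forall>i. i \<notin> - R \<longrightarrow> x $ i = 0}"
  have sub: "subspace S" "subspace S'" "subspace T" "subspace T'"
    unfolding S_def S'_def T_def T'_def
    using p by (auto simp: linear_subspace_image) (auto simp: subspace_def orthogonal_clauses)
  have "card R + card (- R) = CARD('n)"
    using card_Un_disjoint[of R "- R"] by simp
  moreover have "dim S' + dim S = dim (UNIV :: (real ^ 'n) set)"
    unfolding S'_def by (rule dim_subspace_orthogonal_to_vectors) (auto simp: sub)
  moreover have dimT: "dim T = card R" "dim T' = card (- R)"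
    unfolding T_def T'_def by (simp_all only: dim_substandard_cart flip: dim_vec_eq)
  ultimately have dims: "dim S = dim T" "dim S' = dim T'"
    using R by (auto simp: S_def)
  obtain f1 where f1: "linear f1" "f1 ` S = T" "\<And>x. x \<in> S \<Longrightarrow> norm (f1 x) = norm x"
    by (rule isometries_subspaces[OF sub(1,3) dims(1)]) blast
  obtain f2 where f2: "linear f2" "f2 ` S' = T'" "\<And>x. x \<in> S' \<Longrightarrow> norm (f2 x) = norm x"
    by (rule isometries_subspaces[OF sub(2,4) dims(2)]) blast
  define f where "f x = f1 (p x) + f2 (x - p x)" for x
  have S: "p x \<in> S" "x - p x \<in> S'" for x
    using orth by (auto simp: S_def S'_def)
  have T: "f1 (p x) \<in> T" "f2 (x - p x) \<in> T'" for x
    using S f1(2) f2(2) by blast+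
  have orthT: "f1 (p x) \<bullet> f2 (x - p x) = 0" for x
    using T[of x] unfolding T_def T'_def inner_vec_def by (intro sum.neutral) auto
  have "linear f"
    unfolding f_def using p f1(1) f2(1)
    by (intro linear_compose_add linear_compose[of p f1, unfolded comp_def]
        linear_compose[of "\<lambda>x. x - p x" f2, unfolded comp_def] linear_compose_sub linear_ident)
  moreover have "norm (f x) = norm x" for x
  proof -
    have "(norm (f x))\<^sup>2 = (norm (f1 (p x)))\<^sup>2 + (norm (f2 (x - p x)))\<^sup>2"
      unfolding f_def by (rule norm_add_Pythagorean) (simp add: orthogonal_def orthT)
    also have "\<dots> = (norm (p x))\<^sup>2 + (norm (x - p x))\<^sup>2"
      using S f1(3) f2(3) by simp
    also have "\<dots> = (norm (p x + (x - p x)))\<^sup>2"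
      by (rule norm_add_Pythagorean[symmetric]) (rule orth)
    finally show ?thesis by simp
  qed
  ultimately have "orthogonal_transformation f"
    by (simp add: orthogonal_transformation)
  moreover have "(norm (p x))\<^sup>2 = (\<Sum>i\<in>R. (f x $ i)\<^sup>2)" for x
  proof -
    have "(norm (p x))\<^sup>2 = (norm (f1 (p x)))\<^sup>2"
      using S f1(3) by simp
    also have "\<dots> = (\<Sum>i\<in>UNIV. (f1 (p x) $ i)\<^sup>2)"
      by (simp add: norm_vec_def L2_set_def sum_nonneg)
    also have "\<dots> = (\<Sum>i\<in>R. (f1 (p x) $ i)\<^sup>2)"
      using T(1)[of x] by (intro sum.mono_neutral_right) (auto simp: T_def)
    also have "\<dots> = (\<Sum>i\<in>R. (f x $ i)\<^sup>2)"
      using T(2)[of x] by (intro sum.cong) (auto simp: T'_def f_def)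
    finally show ?thesis .
  qed
  ultimately show thesis by (rule that)
qed

text \<open>
  The form is \<open>\<parallel>p z\<parallel>\<^sup>2\<close> for \<open>p = B\<^sup>T (B B\<^sup>T)\<^sup>-\<^sup>1 B\<close>, the orthogonal projection onto the row space of \<open>B\<close>.
\<close>
lemma distr_std_mv_normal_quadratic_form:
  fixes B :: "real ^ 'n ^ 'r"
  assumes inv: "invertible (B ** transpose B)"
  shows "distr std_mv_normal borel (\<lambda>z. (B *v z) \<bullet> (matrix_inv (B ** transpose B) *v (B *v z)))
    = chi_square CARD('r)"
proof -
  let ?C = "matrix_inv (B ** transpose B)"
  define p where "p x = transpose B *v (?C *v (B *v x))" for x
  note C = matrix_inv_invertible[OF inv]
  have C1: "B *v (transpose B *v (?C *v w)) = w" for w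
    by (metis C(1) matrix_vector_mul_assoc matrix_vector_mul_lid)
  have C2: "?C *v (B *v (transpose B *v w)) = w" for w
    by (metis C(2) matrix_vector_mul_assoc matrix_vector_mul_lid)
  have tB: "(transpose B *v w) \<bullet> x = w \<bullet> (B *v x)" for w x
    by (simp add: dot_lmul_matrix[symmetric])
  have p: "linear p"
    unfolding p_def by (simp only: matrix_vector_mul_assoc matrix_vector_mul_linear)
  \<comment> \<open>Moving \<open>transpose B\<close> to the other side leaves
    \<open>B *v (x - p x)\<close>, which vanishes because \<open>C1\<close> gives
    \<open>B *v p x = B *v x\<close>.\<close>
  have orth: "orthogonal (p y) (x - p x)" for x y
    unfolding orthogonal_def p_def tB by (simp only: matrix_vector_mult_diff_distrib C1) simp
  have "range p = range ((*v) (transpose B))"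
  proof
    show "range ((*v) (transpose B)) \<subseteq> range p"
      using C2 by (auto simp: p_def image_iff) metis
  qed (auto simp: p_def)
  \<comment> \<open>\<open>C2\<close> exhibits a left inverse of \<open>transpose B\<close>. Hence
    its range, which is that of \<open>p\<close>, has dimension \<open>CARD('r)\<close>; as a
    subspace of the whole space it forces \<open>CARD('r) \<le> CARD('n)\<close>, so that enough
    coordinates exist for \<open>R\<close>.\<close>
  moreover have "inj ((*v) (transpose B))"
    by (metis C2 injI)
  ultimately have dim: "dim (range p) = CARD('r)"
    using dim_image_eq[of "(*v) (transpose B)" UNIV] by (simp add: inj_on_subset)
  have "dim (range p) \<le> CARD('n)"
    using dim_subset_UNIV_cart by blast
  then obtain R :: "'n set" where R: "card R = CARD('r)"
    using dim obtain_subset_with_card_n by metis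
  then obtain e where e: "bij_betw e {0..<CARD('r)} R"
    using ex_bij_betw_nat_finite[of R] by auto
  obtain f where f: "orthogonal_transformation f" "\<And>x. (norm (p x))\<^sup>2 = (\<Sum>i\<in>R. (f x $ i)\<^sup>2)"
    using orthogonal_transformation_projection_to_coordinates[OF p orth] dim R by metis
  note [measurable] = borel_measurable_orthogonal_transformation[OF f(1)]
  have "(B *v z) \<bullet> (?C *v (B *v z)) = (\<Sum>i<CARD('r). (f z $ e i)\<^sup>2)" for z
  proof -
    have "(B *v z) \<bullet> (?C *v (B *v z)) = (norm (p z))\<^sup>2"
    proof -
      have "p z \<bullet> p z = (?C *v (B *v z)) \<bullet> (B *v p z)"
        by (subst (1) p_def) (rule tB)
      also have "B *v p z = B *v z"
        unfolding p_def by (rule C1)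
      finally show ?thesis
        by (simp only: power2_norm_eq_inner inner_commute)
    qed
    also have "\<dots> = (\<Sum>i<CARD('r). (f z $ e i)\<^sup>2)"
      unfolding f(2) using sum.reindex_bij_betw[OF e, of "\<lambda>i. (f z $ i)\<^sup>2"] by (simp add: atLeast0LessThan)
    finally show ?thesis .
  qed
  then have "distr std_mv_normal borel (\<lambda>z. (B *v z) \<bullet> (?C *v (B *v z)))
      = distr std_mv_normal borel (\<lambda>z. \<Sum>i<CARD('r). (f z $ e i)\<^sup>2)"
    by simp
  also have "\<dots> = distr (distr std_mv_normal borel f) borel (\<lambda>z. \<Sum>i<CARD('r). (z $ e i)\<^sup>2)"
    by (subst distr_distr) (auto simp: comp_def)
  also have "\<dots> = chi_square CARD('r)"
    unfolding distr_std_mv_normal_orthogonal_transformation[OF f(1)]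
    using e by (intro distr_std_mv_normal_sum_squares) (simp add: bij_betw_def atLeast0LessThan)
  finally show ?thesis .
qed

subsection \<open>Slutsky's theorem\<close>

text \<open>Where \<open>W n\<close> and \<open>U n\<close> are close, uniform continuity makes the
  integrands differ by less than \<open>r / 2\<close>. On the remaining event \<open>?A n\<close>
  they differ by at most 2, and its probability tends to 0.\<close>

lemma expectation_diff_tendsto_0:
  fixes U W :: "nat \<Rightarrow> 'a \<Rightarrow> real" and f :: "real \<Rightarrow> real"
  assumes "prob_space P" and [measurable]: "\<And>n. U n \<in> borel_measurable P" "\<And>n. W n \<in> borel_measurable P"
    and WU: "tendsto_in_prob P (\<lambda>n \<omega>. W n \<omega> - U n \<omega>) 0"
    and f: "uniformly_continuous_on UNIV f" "\<And>x. \<bar>f x\<bar> \<le> 1"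
  shows "(\<lambda>n. (\<integral>\<omega>. f (W n \<omega>) \<partial>P) - (\<integral>\<omega>. f (U n \<omega>) \<partial>P)) \<longlonglongrightarrow> 0"
proof (rule LIMSEQ_I)
  fix r :: real assume "0 < r"
  interpret prob_space P by fact
  have [measurable]: "f \<in> borel_measurable borel"
    using f(1) by (intro borel_measurable_continuous_onI uniformly_continuous_imp_continuous)
  obtain \<delta> where \<delta>: "0 < \<delta>" "\<And>x y. dist y x < \<delta> \<Longrightarrow> dist (f y) (f x) < r / 2"
    using f(1) \<open>0 < r\<close> unfolding uniformly_continuous_on_def by (meson UNIV_I half_gt_zero)
  let ?A = "\<lambda>n. {\<omega> \<in> space P. dist (W n \<omega> - U n \<omega>) 0 > \<delta> / 2}"
  have int: "integrable P (\<lambda>\<omega>. f (X \<omega>))" if [measurable]: "X \<in> borel_measurable P" for X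
    using f(2) by (intro integrable_const_bound[of _ 1]) auto
  have bound: "\<bar>(\<integral>\<omega>. f (W n \<omega>) \<partial>P) - (\<integral>\<omega>. f (U n \<omega>) \<partial>P)\<bar> \<le> r / 2 + 2 * prob (?A n)" for n
  proof -
    have intA: "integrable P (\<lambda>\<omega>. r / 2 + 2 * indicator (?A n) \<omega> :: real)"
      by (intro Bochner_Integration.integrable_add integrable_mult_right integrable_const integrable_real_indicator)
        (measurable, simp add: less_top[symmetric])
    have pw: "\<bar>f (W n \<omega>) - f (U n \<omega>)\<bar> \<le> r / 2 + 2 * indicator (?A n) \<omega>" if "\<omega> \<in> space P" for \<omega>
    proof (cases "\<omega> \<in> ?A n")
      case True
      then show ?thesis using f(2)[of "W n \<omega>"] f(2)[of "U n \<omega>"] \<open>0 < r\<close> by simp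
    next
      case False
      then have "dist (W n \<omega>) (U n \<omega>) < \<delta>" using that \<delta>(1) by (simp add: dist_real_def)
      from \<delta>(2)[OF this] False show ?thesis by (simp add: dist_real_def)
    qed
    have "\<bar>(\<integral>\<omega>. f (W n \<omega>) \<partial>P) - (\<integral>\<omega>. f (U n \<omega>) \<partial>P)\<bar> = \<bar>\<integral>\<omega>. f (W n \<omega>) - f (U n \<omega>) \<partial>P\<bar>"
      by (simp add: int)
    also have "\<dots> \<le> (\<integral>\<omega>. \<bar>f (W n \<omega>) - f (U n \<omega>)\<bar> \<partial>P)"
      by (rule integral_abs_bound)
    also have "\<dots> \<le> (\<integral>\<omega>. r / 2 + 2 * indicator (?A n) \<omega> \<partial>P)"
    proof (rule integral_mono)
      show "integrable P (\<lambda>\<omega>. \<bar>f (W n \<omega>) - f (U n \<omega>)\<bar>)"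
        by (intro integrable_abs Bochner_Integration.integrable_diff int) auto
      show "integrable P (\<lambda>\<omega>. r / 2 + 2 * indicator (?A n) \<omega>)"
        by (rule intA)
    qed (rule pw)
    also have "\<dots> = r / 2 + 2 * (\<integral>\<omega>. indicator (?A n) \<omega> \<partial>P)"
      by (subst Bochner_Integration.integral_add) (auto simp: prob_space intro!: integrable_real_indicator simp: less_top[symmetric])
    also have "(\<integral>\<omega>. indicator (?A n) \<omega> \<partial>P) = prob (?A n)"
      by (subst Bochner_Integration.integral_indicator) (auto intro!: arg_cong[where f = prob])
    finally show ?thesis .
  qed
  have "(\<lambda>n. prob (?A n)) \<longlonglongrightarrow> 0"
    using WU half_gt_zero[OF \<delta>(1)] unfolding tendsto_in_prob_def by blast
  \<comment> \<open>With this threshold the bound \<open>r / 2 + 2 * prob (?A n)\<close> falls below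
    \<open>r\<close>.\<close>
  then have "\<forall>\<^sub>F n in sequentially. prob (?A n) < r / 4"
    using \<open>0 < r\<close> by (intro order_tendstoD(2)) auto
  then obtain N where N: "\<And>n. n \<ge> N \<Longrightarrow> prob (?A n) < r / 4"
    unfolding eventually_sequentially by blast
  show "\<exists>N. \<forall>n\<ge>N. norm ((\<integral>\<omega>. f (W n \<omega>) \<partial>P) - (\<integral>\<omega>. f (U n \<omega>) \<partial>P) - 0) < r"
  proof (intro exI allI impI)
    fix n assume "n \<ge> N"
    with bound[of n] N[of n] show "norm ((\<integral>\<omega>. f (W n \<omega>) \<partial>P) - (\<integral>\<omega>. f (U n \<omega>) \<partial>P) - 0) < r"
      by simp
  qed
qed

text \<open>Replacing \<open>X n\<close> by \<open>c\<close> changes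
  \<open>g (Z n \<omega>) (X n \<omega>)\<close> by a quantity that tends to 0 in probability. What
  is left is a continuous function of \<open>Z n\<close> alone, to which the weak convergence of
  \<open>Z n\<close> applies.\<close>

lemma slutsky:
  fixes Z :: "nat \<Rightarrow> 'a \<Rightarrow> 'b :: euclidean_space" and X :: "nat \<Rightarrow> 'a \<Rightarrow> 'c :: euclidean_space"
    and g :: "'b \<Rightarrow> 'c \<Rightarrow> real"
  assumes P: "prob_space P" and Z [measurable]: "\<And>n. Z n \<in> borel_measurable P"
    and X [measurable]: "\<And>n. X n \<in> borel_measurable P"
    and N: "prob_space N" and sets [measurable_cong]: "sets N = sets borel"
    and conv: "weak_conv_measures (\<lambda>n. distr P borel (Z n)) N"
    and Xc: "tendsto_in_prob P X c"
    and g: "continuous_on UNIV (\<lambda>(z, x). g z x)"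
  shows "weak_conv_m (\<lambda>n. distr P borel (\<lambda>\<omega>. g (Z n \<omega>) (X n \<omega>))) (distr N borel (\<lambda>z. g z c))"
proof -
  interpret P: prob_space P by fact
  interpret N: prob_space N by fact
  have gm [measurable]: "(\<lambda>(z, x). g z x) \<in> borel_measurable borel"
    by (rule borel_measurable_continuous_onI[OF g])
  have WM: "(\<lambda>\<omega>. g (Z n \<omega>) (X n \<omega>)) \<in> borel_measurable P" for n
    using measurable_compose[OF borel_measurable_Pair[OF Z X] gm] by simp
  have gc: "continuous_on UNIV (\<lambda>z. g z c)"
    using continuous_on_compose2[OF g continuous_on_Pair[OF continuous_on_id continuous_on_const], of c] by simp
  have gcm [measurable]: "(\<lambda>z. g z c) \<in> borel_measurable borel"
    by (rule borel_measurable_continuous_onI[OF gc])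
  \<comment> \<open>\<open>g\<close> need not be uniformly continuous on the whole space. Tightness
    confines \<open>Z n\<close> to a ball up to probability \<open>r / 2\<close>, and on a compact
    product \<open>g\<close> is uniformly continuous.\<close>
  have diff: "tendsto_in_prob P (\<lambda>n \<omega>. g (Z n \<omega>) (X n \<omega>) - g (Z n \<omega>) c) 0"
    unfolding tendsto_in_prob_def
  proof (intro allI impI)
    fix \<delta> :: real assume "\<delta> > 0"
    let ?A = "\<lambda>n. {\<omega> \<in> space P. dist (g (Z n \<omega>) (X n \<omega>) - g (Z n \<omega>) c) 0 > \<delta>}"
    show "(\<lambda>n. P.prob (?A n)) \<longlonglongrightarrow> 0"
    proof (rule LIMSEQ_I)
      fix r :: real assume "0 < r"
      obtain K where "K > 0" and K: "\<forall>\<^sub>F n in sequentially. P.prob {\<omega> \<in> space P. norm (Z n \<omega>) > K} < r / 2"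
        using tight_of_weak_conv[OF P Z N sets conv, of "r / 2"] \<open>0 < r\<close> by auto
      have "uniformly_continuous_on (cball 0 K \<times> cball c 1) (\<lambda>(z, x). g z x)"
        by (intro compact_uniformly_continuous compact_Times compact_cball continuous_on_subset[OF g]) auto
      then obtain d where d: "d > 0" "\<And>p q. p \<in> cball 0 K \<times> cball c 1 \<Longrightarrow> q \<in> cball 0 K \<times> cball c 1 \<Longrightarrow>
          dist q p < d \<Longrightarrow> dist (case q of (z, x) \<Rightarrow> g z x) (case p of (z, x) \<Rightarrow> g z x) < \<delta>"
        unfolding uniformly_continuous_on_def using \<open>\<delta> > 0\<close> by meson
      \<comment> \<open>The halving makes \<open>dist (X n \<omega>) c \<le> e\<close> imply both a
        distance strictly below \<open>d\<close> and membership in \<open>cball c 1\<close>.\<close>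
      define e where "e = min d 1 / 2"
      have e: "e > 0" "e < d" "e < 1" using d(1) by (auto simp: e_def)
      let ?K = "\<lambda>n. {\<omega> \<in> space P. norm (Z n \<omega>) > K}"
      let ?X = "\<lambda>n. {\<omega> \<in> space P. dist (X n \<omega>) c > e}"
      have sub: "?A n \<subseteq> ?K n \<union> ?X n" for n
      proof
        fix \<omega> assume \<omega>: "\<omega> \<in> ?A n"
        show "\<omega> \<in> ?K n \<union> ?X n"
        proof (rule ccontr)
          assume "\<omega> \<notin> ?K n \<union> ?X n"
          with \<omega> have "norm (Z n \<omega>) \<le> K" "dist (X n \<omega>) c \<le> e" by auto
          then have "dist (g (Z n \<omega>) (X n \<omega>)) (g (Z n \<omega>) c) < \<delta>"
            using d(2)[of "(Z n \<omega>, c)" "(Z n \<omega>, X n \<omega>)"] e by (simp add: dist_Pair_Pair dist_commute)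
          with \<omega> show False by (simp add: dist_real_def)
        qed
      qed
      have "P.prob (?A n) \<le> P.prob (?K n \<union> ?X n)" for n
        by (rule P.finite_measure_mono[OF sub]) measurable
      also have "P.prob (?K n \<union> ?X n) \<le> P.prob (?K n) + P.prob (?X n)" for n
        by (intro measure_subadditive) auto
      finally have le: "P.prob (?A n) \<le> P.prob (?K n) + P.prob (?X n)" for n .
      have "(\<lambda>n. P.prob (?X n)) \<longlonglongrightarrow> 0"
        using Xc e(1) unfolding tendsto_in_prob_def by blast
      then have "\<forall>\<^sub>F n in sequentially. P.prob (?X n) < r / 2"
        using \<open>0 < r\<close> by (intro order_tendstoD(2)) auto
      with K have "\<forall>\<^sub>F n in sequentially. P.prob (?A n) < r"
      proof eventually_elim
        case (elim n)
        with le[of n] show ?case by linarith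
      qed
      then show "\<exists>N. \<forall>n\<ge>N. norm (P.prob (?A n) - 0) < r"
        by (simp add: eventually_sequentially)
    qed
  qed
  show ?thesis
  \<comment> \<open>On the real line it suffices to test against the piecewise linear functions
    \<open>cts_step x y\<close>. They are uniformly continuous and bounded by 1, as
    \<open>expectation_diff_tendsto_0\<close> requires.\<close>
  proof (rule integral_cts_step_conv_imp_weak_conv)
    show "real_distribution (distr P borel (\<lambda>\<omega>. g (Z n \<omega>) (X n \<omega>)))" for n
      using WM by (simp add: real_distribution_def real_distribution_axioms_def P.prob_space_distr)
    show "real_distribution (distr N borel (\<lambda>z. g z c))"
      by (simp add: real_distribution_def real_distribution_axioms_def N.prob_space_distr)
  next
    fix x y :: real assume "x < y"
    let ?f = "cts_step x y"
    have f: "uniformly_continuous_on UNIV ?f" by (rule cts_step_uniformly_continuous) fact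
    have f1: "\<bar>?f t\<bar> \<le> 1" for t using \<open>x < y\<close> by (auto simp: cts_step_def)
    have fc: "continuous_on UNIV ?f" by (rule uniformly_continuous_imp_continuous[OF f])
    have fm [measurable]: "?f \<in> borel_measurable borel" by (rule borel_measurable_continuous_onI[OF fc])
    have "continuous_on UNIV (\<lambda>z. ?f (g z c))"
      using continuous_on_compose2[OF fc gc] by simp
    moreover have "bounded (range (\<lambda>z. ?f (g z c)))"
      using f1 by (intro boundedI[of _ 1]) auto
    ultimately have "(\<lambda>n. \<integral>z. ?f (g z c) \<partial>distr P borel (Z n)) \<longlonglongrightarrow> (\<integral>z. ?f (g z c) \<partial>N)"
      using conv unfolding weak_conv_measures_def by blast
    then have "(\<lambda>n. \<integral>\<omega>. ?f (g (Z n \<omega>) c) \<partial>P) \<longlonglongrightarrow> (\<integral>z. ?f (g z c) \<partial>N)"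
      by (simp add: integral_distr)
    moreover have "(\<lambda>n. (\<integral>\<omega>. ?f (g (Z n \<omega>) (X n \<omega>)) \<partial>P) - (\<integral>\<omega>. ?f (g (Z n \<omega>) c) \<partial>P)) \<longlonglongrightarrow> 0"
      by (rule expectation_diff_tendsto_0[OF P _ WM diff f f1]) measurable
    ultimately have "(\<lambda>n. \<integral>\<omega>. ?f (g (Z n \<omega>) (X n \<omega>)) \<partial>P) \<longlonglongrightarrow> (\<integral>z. ?f (g z c) \<partial>N)"
      using tendsto_add by fastforce
    then show "(\<lambda>n. integral\<^sup>L (distr P borel (\<lambda>\<omega>. g (Z n \<omega>) (X n \<omega>))) ?f) \<longlonglongrightarrow>
        integral\<^sup>L (distr N borel (\<lambda>z. g z c)) ?f"
      using WM by (simp add: integral_distr)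
  qed
qed

subsection \<open>The Wald statistic\<close>

lemma borel_measurable_vecI:
  fixes f :: "'a \<Rightarrow> ('b :: euclidean_space) ^ 'n"
  assumes "\<And>i. (\<lambda>x. f x $ i) \<in> borel_measurable M"
  shows "f \<in> borel_measurable M"
proof (subst borel_measurable_euclidean_space, rule ballI)
  fix b :: "'b ^ 'n" assume "b \<in> Basis"
  then obtain i u where "b = axis i u"
    unfolding Basis_vec_def by blast
  then show "(\<lambda>x. f x \<bullet> b) \<in> borel_measurable M"
    by (simp only: inner_axis) (intro borel_measurable_inner assms borel_measurable_const)
qed

lemma borel_measurable_vec_nth:
  fixes f :: "'a \<Rightarrow> ('b :: euclidean_space) ^ 'n"
  assumes "f \<in> borel_measurable M"
  shows "(\<lambda>x. f x $ i) \<in> borel_measurable M"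
  by (rule measurable_compose[OF assms borel_measurable_continuous_onI]) (intro continuous_intros)

lemma borel_measurable_matrix_mult:
  fixes A :: "'a \<Rightarrow> real ^ 'n ^ 'm" and B :: "'a \<Rightarrow> real ^ 'p ^ 'n"
  assumes "A \<in> borel_measurable M" "B \<in> borel_measurable M"
  shows "(\<lambda>x. A x ** B x) \<in> borel_measurable M"
  using assms
  by (intro borel_measurable_vecI) (auto simp: matrix_matrix_mult_def intro!: borel_measurable_sum borel_measurable_times borel_measurable_vec_nth)

lemma tendsto_matrix_mult:
  fixes A :: "'a \<Rightarrow> real ^ 'n ^ 'm" and B :: "'a \<Rightarrow> real ^ 'p ^ 'n"
  assumes "(A \<longlongrightarrow> a) F" "(B \<longlongrightarrow> b) F"
  shows "((\<lambda>x. A x ** B x) \<longlongrightarrow> a ** b) F"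
  using assms by (intro vec_tendstoI) (auto simp: matrix_matrix_mult_def intro!: tendsto_intros)

lemma borel_measurable_logistic_prob:
  fixes b :: "'a \<Rightarrow> real ^ (('d :: finite) \<times> ('q :: finite))"
  assumes [measurable]: "b \<in> borel_measurable M"
  shows "(\<lambda>\<omega>. logistic_prob x (b \<omega>) $ s) \<in> borel_measurable M"
proof -
  have [measurable]: "(\<lambda>\<omega>. lin_pred x (b \<omega>) r) \<in> borel_measurable M" for r
    unfolding lin_pred_def inner_vec_def
    by (auto intro!: borel_measurable_sum borel_measurable_times borel_measurable_vec_nth)
  show ?thesis
    unfolding logistic_prob_def by (cases s) auto
qed

lemma borel_measurable_J_mat:
  fixes b :: "'a \<Rightarrow> real ^ (('d :: finite) \<times> ('q :: finite))"
  assumes b: "b \<in> borel_measurable M"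
  shows "(\<lambda>\<omega>. J_mat D (b \<omega>)) \<in> borel_measurable M"
proof -
  note [measurable] = borel_measurable_logistic_prob[OF b]
  have "(\<lambda>\<omega>. kron_mat (Delta_mat (drop_last (logistic_prob x (b \<omega>)))) (outer_prod x x)) \<in> borel_measurable M" for x :: "real ^ 'q"
  proof (intro borel_measurable_vecI)
    fix k l
    show "(\<lambda>\<omega>. kron_mat (Delta_mat (drop_last (logistic_prob x (b \<omega>)))) (outer_prod x x) $ k $ l) \<in> borel_measurable M"
      by (cases "fst k = fst l") (simp_all add: kron_mat_def Delta_mat_def drop_last_def outer_prod_def)
  qed
  then show ?thesis
    unfolding J_mat_def by (intro borel_measurable_scaleR borel_measurable_sum borel_measurable_const)
qed

lemma (in survey_model) borel_measurable_G_hat: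
  assumes b: "b \<in> borel_measurable P"
  shows "(\<lambda>\<omega>. G_hat D (\<lambda>h i j. Y h i j \<omega>) (b \<omega>)) \<in> borel_measurable P"
proof -
  note [measurable] = borel_measurable_logistic_prob[OF b]
  \<comment> \<open>The responses are known to be measurable only for units inside the design, so
    the index ranges have to be carried along.\<close>
  have score_hi: "(\<lambda>\<omega>. score_hi D (\<lambda>h i j. Y h i j \<omega>) (b \<omega>) h i) \<in> borel_measurable P"
    if "h \<in> {1..strata D}" "i \<in> {1..clusters D h}" for h i
  proof -
    have "(\<lambda>\<omega>. counts D (\<lambda>h i j. Y h i j \<omega>) h i) \<in> borel_measurable P"
      unfolding counts_def using that
      by (intro borel_measurable_sum Y_measurable) (auto simp: cluster_index_def)
    note [measurable] = borel_measurable_vec_nth[OF this]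
    show ?thesis
      unfolding score_hi_def
      by (intro borel_measurable_scaleR borel_measurable_const borel_measurable_vecI)
        (auto simp: kron_vec_def drop_last_def)
  qed
  have "(\<lambda>\<omega>. score D (\<lambda>h i j. Y h i j \<omega>) (b \<omega>)) \<in> borel_measurable P"
    unfolding score_def by (intro borel_measurable_sum score_hi)
  note score = borel_measurable_vec_nth[OF this, measurable]
  show ?thesis
    unfolding G_hat_def
  proof (intro borel_measurable_scaleR borel_measurable_sum borel_measurable_const)
    fix h i assume "h \<in> {1..strata D}" "i \<in> {1..clusters D h}"
    note [measurable] = borel_measurable_vec_nth[OF score_hi[OF this]]
    show "(\<lambda>\<omega>. outer_prod
         (score_hi D (\<lambda>h i j. Y h i j \<omega>) (b \<omega>) h i - (1 / real (num_clusters D)) *\<^sub>R score D (\<lambda>h i j. Y h i j \<omega>) (b \<omega>))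
         (score_hi D (\<lambda>h i j. Y h i j \<omega>) (b \<omega>) h i - (1 / real (num_clusters D)) *\<^sub>R score D (\<lambda>h i j. Y h i j \<omega>) (b \<omega>)))
       \<in> borel_measurable P"
      by (intro borel_measurable_vecI) (auto simp: outer_prod_def)
  qed
qed

text \<open>Two inversions occur, one of \<open>J\<close> and one of the compressed sandwich. Each
  is taken at an invertible matrix, hence is continuous there, and the matrix products between them
  are continuous.\<close>

lemma isCont_matrix_inv_sandwich:
  fixes J G :: "real ^ 'n ^ 'n" and M :: "real ^ 'r ^ 'n"
  assumes "invertible J" "invertible (transpose M ** sandwich J G ** M)"
  shows "isCont (\<lambda>(J, G). matrix_inv (transpose M ** sandwich J G ** M)) (J, G)"
proof -
  have fst: "(fst \<longlongrightarrow> J) (at (J, G))" and snd: "(snd \<longlongrightarrow> G) (at (J, G))"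
    using tendsto_fst[OF tendsto_ident_at] tendsto_snd[OF tendsto_ident_at] by (metis fst_conv snd_conv)+
  have "((\<lambda>p. matrix_inv (fst p)) \<longlongrightarrow> matrix_inv J) (at (J, G))"
    using isCont_tendsto_compose[OF isCont_matrix_inv[OF assms(1)] fst] .
  then have "((\<lambda>p. transpose M ** sandwich (fst p) (snd p) ** M) \<longlongrightarrow> transpose M ** sandwich J G ** M) (at (J, G))"
    unfolding sandwich_def using snd by (intro tendsto_matrix_mult tendsto_const)
  then show ?thesis
    unfolding isCont_def split_beta
    using isCont_tendsto_compose[OF isCont_matrix_inv[OF assms(2)]] by simp
qed

text \<open>Writing \<open>N\<close> as the law of \<open>A *v z\<close> with \<open>z\<close>
  standard normal and putting \<open>B = transpose M ** A\<close> turns the middle matrix into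
  \<open>B ** transpose B\<close>, which reduces the claim to the standard normal case.
  \<open>V\<close> itself may be singular.\<close>

lemma distr_mv_normal_quadratic_form:
  fixes M :: "real ^ 'r ^ 'n" and V :: "real ^ 'n ^ 'n"
  assumes N: "mv_normal N 0 V" and inv: "invertible (transpose M ** V ** M)"
  shows "distr N borel (\<lambda>z. (transpose M *v z) \<bullet> (matrix_inv (transpose M ** V ** M) *v (transpose M *v z)))
    = chi_square CARD('r)"
proof -
  obtain A :: "real ^ 'n ^ 'n" where A: "A ** transpose A = V" "N = distr std_mv_normal borel (\<lambda>z. 0 + A *v z)"
    using N unfolding mv_normal_def by blast
  define B where "B = transpose M ** A"
  have B: "transpose M ** V ** M = B ** transpose B"
    by (simp add: B_def A(1)[symmetric] matrix_transpose_mul matrix_mul_assoc)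
  have Bv: "transpose M *v (A *v z) = B *v z" for z
    by (simp only: B_def matrix_vector_mul_assoc)
  have lin [measurable]: "(\<lambda>z. C *v z) \<in> borel_measurable borel" for C :: "real ^ 'a ^ 'b"
    by (intro borel_measurable_continuous_onI linear_continuous_on linear_conv_bounded_linear[THEN iffD1])
      (rule matrix_vector_mul_linear)
  have [measurable]: "(\<lambda>z. (transpose M *v z) \<bullet> (C *v (transpose M *v z))) \<in> borel_measurable borel" for C
    unfolding matrix_vector_mul_assoc by (intro borel_measurable_inner lin)
  have "distr N borel (\<lambda>z. (transpose M *v z) \<bullet> (matrix_inv (transpose M ** V ** M) *v (transpose M *v z)))
      = distr std_mv_normal borel (\<lambda>z. (B *v z) \<bullet> (matrix_inv (B ** transpose B) *v (B *v z)))"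
    unfolding A(2) B by (subst distr_distr) (simp_all only: comp_def add_0 Bv, measurable)
  also have "\<dots> = chi_square CARD('r)"
    using inv unfolding B by (rule distr_std_mv_normal_quadratic_form)
  finally show ?thesis .
qed

section \<open>Limit law of the Wald statistic\<close>

theorem theorem3p2:
  fixes P :: "'a measure"
    and D :: "nat \<Rightarrow> ('q :: finite) design"
    and first :: 'q
    and Y :: "nat \<Rightarrow> nat \<Rightarrow> nat \<Rightarrow> nat \<Rightarrow> 'a \<Rightarrow> real ^ (('d :: finite) option)"
    and \<beta>\<^sub>0 :: "real ^ ('d \<times> 'q)"
    and H :: nat
    and \<eta> :: "nat \<Rightarrow> real"
    and \<phi> :: "real \<Rightarrow> ereal"
    and bhat :: "nat \<Rightarrow> 'a \<Rightarrow> real ^ ('d \<times> 'q)"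
    and J G V :: "real ^ ('d \<times> 'q) ^ ('d \<times> 'q)"
    and N :: "(real ^ ('d \<times> 'q)) measure"
    and M :: "real ^ ('r :: finite) ^ ('d \<times> 'q)"
    and m :: "real ^ 'r"
  assumes model: "\<And>n. survey_model P (D n) first (Y n) \<beta>\<^sub>0"
    and strata: "\<And>n. strata (D n) = H"
    and size: "\<And>n. num_clusters (D n) = n"
    and proportions: "\<And>h. h \<in> {1..H} \<Longrightarrow> (\<lambda>n. real (clusters (D n) h) / real n) \<longlonglongrightarrow> \<eta> h"
    and phi: "\<phi> \<in> phi_class"
    and estimator: "\<And>n. pseudo_min_phi_estimator P (D n) (Y n) \<phi> (bhat n)"
    and J_lim: "(\<lambda>n. J_mat (D n) \<beta>\<^sub>0) \<longlonglongrightarrow> J"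
    and G_lim: "(\<lambda>n. G_mat P (D n) (Y n)) \<longlonglongrightarrow> G"
    and V_eq: "V = sandwich J G"
    and J_inv: "invertible J"
    and normal: "mv_normal N 0 V"
    and asymp_normal:
      "weak_conv_measures (\<lambda>n. distr P borel (\<lambda>\<omega>. sqrt (real n) *\<^sub>R (bhat n \<omega> - \<beta>\<^sub>0))) N"
    and J_consistent: "tendsto_in_prob P (\<lambda>n \<omega>. J_mat (D n) (bhat n \<omega>)) J"
    and G_consistent:
      "tendsto_in_prob P (\<lambda>n \<omega>. G_hat (D n) (\<lambda>h i j. Y n h i j \<omega>) (bhat n \<omega>)) G"
    and r_le: "CARD('r) \<le> CARD('d \<times> 'q)"
    and full_rank: "rank M = CARD('r)"
    and MVM_inv: "invertible (transpose M ** V ** M)"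
    and null_hyp: "transpose M *v \<beta>\<^sub>0 = m"
  shows "weak_conv_m
           (\<lambda>n. distr P borel (\<lambda>\<omega>. wald_stat (D n) (\<lambda>h i j. Y n h i j \<omega>) M m (bhat n \<omega>)))
           (chi_square CARD('r))"
proof -
  have P: "prob_space P" by (rule survey_model.axioms(1)[OF model])
  have b: "bhat n \<in> borel_measurable P" for n
    using estimator by (simp add: pseudo_min_phi_estimator_def)
  define G' where "G' n \<omega> = G_hat (D n) (\<lambda>h i j. Y n h i j \<omega>) (bhat n \<omega>)" for n \<omega>
  define Z where "Z n \<omega> = sqrt (real n) *\<^sub>R (bhat n \<omega> - \<beta>\<^sub>0)" for n \<omega>
  define C where "C J' G'' = matrix_inv (transpose M ** sandwich J' G'' ** M)" for J' G''
  define X where "X n \<omega> = C (J_mat (D n) (bhat n \<omega>)) (G' n \<omega>)" for n \<omega>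
  define g where "g z x = (transpose M *v z) \<bullet> (x *v (transpose M *v z))" for z and x :: "real ^ 'r ^ 'r"
  note J_meas = borel_measurable_J_mat[OF b]
  have G_meas: "G' n \<in> borel_measurable P" for n
    unfolding G'_def[abs_def] by (rule survey_model.borel_measurable_G_hat[OF model b])
  have Z_meas: "Z n \<in> borel_measurable P" for n
    unfolding Z_def[abs_def]
    by (intro borel_measurable_scaleR borel_measurable_diff borel_measurable_const b)
  have X_meas: "X n \<in> borel_measurable P" for n
    unfolding X_def[abs_def] C_def sandwich_def
    by (intro measurable_compose[OF _ borel_measurable_matrix_inv] borel_measurable_matrix_mult
        borel_measurable_const J_meas G_meas)
  have "tendsto_in_prob P (\<lambda>n \<omega>. (J_mat (D n) (bhat n \<omega>), G' n \<omega>)) (J, G)"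
    using G_consistent unfolding G'_def[symmetric]
    by (rule tendsto_in_prob_Pair[OF P J_consistent _ J_meas G_meas])
  \<comment> \<open>Continuity of \<open>C\<close> at the single point \<open>(J, G)\<close> is
    enough: estimates for which an inverse fails to exist only occur away from the limit, with
    vanishing probability.\<close>
  then have "tendsto_in_prob P (\<lambda>n \<omega>. case_prod C (J_mat (D n) (bhat n \<omega>), G' n \<omega>)) (case_prod C (J, G))"
  proof (rule tendsto_in_prob_isCont[OF P])
    show "isCont (case_prod C) (J, G)"
      unfolding C_def using isCont_matrix_inv_sandwich J_inv MVM_inv V_eq by blast
  qed (intro borel_measurable_Pair J_meas G_meas)
  then have X_lim: "tendsto_in_prob P X (C J G)"
    by (simp add: X_def[abs_def])
  have "prob_space N" "sets N = sets borel"
  proof -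
    interpret S: prob_space "std_mv_normal :: (real ^ ('d \<times> 'q)) measure"
      by (rule prob_space_std_mv_normal)
    obtain A :: "real ^ ('d \<times> 'q) ^ ('d \<times> 'q)" where N: "N = distr std_mv_normal borel (\<lambda>z. 0 + A *v z)"
      using normal unfolding mv_normal_def by blast
    show "sets N = sets borel" by (simp add: N)
    have "(\<lambda>z. 0 + A *v z) \<in> borel_measurable borel"
      by (intro borel_measurable_continuous_onI continuous_on_add continuous_on_const
          linear_continuous_on linear_conv_bounded_linear[THEN iffD1] matrix_vector_mul_linear)
    then show "prob_space N"
      unfolding N by (intro S.prob_space_distr) simp
  qed
  moreover have "continuous_on UNIV (\<lambda>(z, x). g z x)"
    unfolding g_def split_beta inner_vec_def matrix_vector_mult_def
    by (simp, intro continuous_intros)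
  ultimately have "weak_conv_m (\<lambda>n. distr P borel (\<lambda>\<omega>. g (Z n \<omega>) (X n \<omega>))) (distr N borel (\<lambda>z. g z (C J G)))"
    using asymp_normal X_lim by (intro slutsky[OF P Z_meas X_meas]) (simp_all add: Z_def[abs_def])
  \<comment> \<open>The null hypothesis replaces \<open>transpose M *v \<beta>\<^sub>0\<close> by
    \<open>m\<close>. The quadratic form then collects one factor \<open>sqrt (real n)\<close> from
    each side, and together they are the factor \<open>n\<close> of the statistic, since
    \<open>size\<close> makes the number of clusters equal to \<open>n\<close>.\<close>
  moreover have "g (Z n \<omega>) (X n \<omega>) = wald_stat (D n) (\<lambda>h i j. Y n h i j \<omega>) M m (bhat n \<omega>)" for n \<omega>
  proof -
    have "transpose M *v Z n \<omega> = sqrt (real n) *\<^sub>R (transpose M *v bhat n \<omega> - m)"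
      by (simp only: Z_def null_hyp[symmetric] matrix_vector_mult_diff_distrib matrix_vector_mult_scaleR)
    then show ?thesis
      by (simp only: g_def wald_stat_def X_def C_def G'_def V_hat_def size)
        (simp add: matrix_vector_mult_scaleR)
  qed
  moreover have "distr N borel (\<lambda>z. g z (C J G)) = chi_square CARD('r)"
    unfolding g_def C_def V_eq[symmetric] by (rule distr_mv_normal_quadratic_form[OF normal MVM_inv])
  ultimately show ?thesis by simp
qed

end
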